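(* The slice regular Bergman kernel of the second kind for the unit ball $\mathbb B^4=\{q\in\mathbb H: |q|<1\}$ is, for $q,r\in\mathbb B^4$, $$\mathcal K_{\mathbb B^4}(q,r)=\frac1\pi\,(1-2\bar q\,\bar r+\bar q^2\bar r^2)\,(1-2\,\mathrm{Re}[q]\,\bar r+|q|^2\bar r^2)^{-2}.$$
   Context: $\mathbb H$ is the algebra of real quaternions, $\mathbb S^2$ is the set of purely imaginary quaternions of modulus $1$, and for $\mathbf i\in\mathbb S^2$, $\mathbb C(\mathbf i)=\{x+y\mathbf i: x,y\in\mathbb R\}$. For $\Omega\subseteq\mathbb H$ put $\Omega_{\mathbf i}=\Omega\cap\mathbb C(\mathbf i)$. $\mathcal{SR}(\Omega)$ is the set of (left) slice regular functions on the open set $\Omega$: real differentiable $f:\Omega\to\mathbb H$ such that for every $\mathbf i\in\mathbb S^2$, $\left(\frac{\partial}{\partial x}+\mathbf i\frac{\partial}{\partial y}\right)f|_{\Omega_{\mathbf i}}(x+y\mathbf i)=0$ on $\Omega_{\mathbf i}$. Let $\Omega=\mathbb B^4$. For $\mathbf j\in\mathbb S^2$, $\mathcal A(\Omega_{\mathbf j})=\{f\in\mathcal{SR}(\Omega): \int_{\Omega_{\mathbf j}}|f|^2d\sigma_{\mathbf j}<\infty\}$, with $d\sigma_{\mathbf j}(x+\mathbf j y)=dx\,dy$, is a quaternionic right Hilbert space with inner product $\langle f,g\rangle=\int_{\Omega_{\mathbf j}}\overline f\,g\,d\sigma_{\mathbf j}$. For $q\in\Omega_{\mathbf j}$ evaluation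 at $q$ is a bounded right linear functional, so there is a unique $K_q(\mathbf j)\in\mathcal A(\Omega_{\mathbf j})$ with $f(q)=\langle K_q(\mathbf j),f\rangle$ for all $f\in\mathcal A(\Omega_{\mathbf j})$. The slice Bergman kernel associated with $\Omega_{\mathbf j}$ is $\mathcal K_{\Omega_{\mathbf j}}(q,r)=\overline{K_q(\mathbf j)(r)}$, $q,r\in\Omega_{\mathbf j}$. The slice Bergman kernel of the second kind $\mathcal K_\Omega:\Omega\times\Omega\to\mathbb H$ is the extension in the first variable: for $r\in\Omega$, choose $\mathbf j\in\mathbb S^2$ with $r\in\Omega_{\mathbf j}$, and for $q=x+y\mathbf i\in\Omega$ ($x,y\in\mathbb R$, $\mathbf i\in\mathbb S^2$) put $$\mathcal K_\Omega(x+y\mathbf i,r)=\tfrac12(1-\mathbf i\mathbf j)\,\mathcal K_{\Omega_{\mathbf j}}(x+y\mathbf j,r)+\tfrac12(1+\mathbf i\mathbf j)\,\mathcal K_{\Omega_{\mathbf j}}(x-y\mathbf j,r).$$ *)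

theory Defs
  imports "HOL-Analysis.Analysis"
begin

datatype quat = Quat (qre: real) (qim1: real) (qim2: real) (qim3: real)

lemma quat_eq_iff:
  "p = q \<longleftrightarrow> qre p = qre q \<and> qim1 p = qim1 q \<and> qim2 p = qim2 q \<and> qim3 p = qim3 q"
  by (cases p; cases q) auto

instantiation quat :: ring_1
begin

definition "0 = Quat 0 0 0 0"
definition "1 = Quat 1 0 0 0"
definition "p + q = Quat (qre p + qre q) (qim1 p + qim1 q) (qim2 p + qim2 q) (qim3 p + qim3 q)"
definition "p - q = Quat (qre p - qre q) (qim1 p - qim1 q) (qim2 p - qim2 q) (qim3 p - qim3 q)"
definition "- p = Quat (- qre p) (- qim1 p) (- qim2 p) (- qim3 p)"
definition "p * q = Quat
  (qre p * qre q - qim1 p * qim1 q - qim2 p * qim2 q - qim3 p * qim3 q)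
  (qre p * qim1 q + qim1 p * qre q + qim2 p * qim3 q - qim3 p * qim2 q)
  (qre p * qim2 q - qim1 p * qim3 q + qim2 p * qre q + qim3 p * qim1 q)
  (qre p * qim3 q + qim1 p * qim2 q - qim2 p * qim1 q + qim3 p * qre q)"

instance
  by standard (simp_all add: quat_eq_iff zero_quat_def one_quat_def plus_quat_def
      minus_quat_def uminus_quat_def times_quat_def algebra_simps)

end

lemma quat_sel_simps [simp]:
  "qre 0 = 0" "qim1 0 = 0" "qim2 0 = 0" "qim3 0 = 0"
  "qre 1 = 1" "qim1 1 = 0" "qim2 1 = 0" "qim3 1 = 0"
  "qre (p + q) = qre p + qre q" "qim1 (p + q) = qim1 p + qim1 q"
  "qim2 (p + q) = qim2 p + qim2 q" "qim3 (p + q) = qim3 p + qim3 q"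
  "qre (p - q) = qre p - qre q" "qim1 (p - q) = qim1 p - qim1 q"
  "qim2 (p - q) = qim2 p - qim2 q" "qim3 (p - q) = qim3 p - qim3 q"
  "qre (- p) = - qre p" "qim1 (- p) = - qim1 p" "qim2 (- p) = - qim2 p" "qim3 (- p) = - qim3 p"
  by (simp_all add: zero_quat_def one_quat_def plus_quat_def minus_quat_def uminus_quat_def)

lemma quat_times_sel:
  "qre (p * q) = qre p * qre q - qim1 p * qim1 q - qim2 p * qim2 q - qim3 p * qim3 q"
  "qim1 (p * q) = qre p * qim1 q + qim1 p * qre q + qim2 p * qim3 q - qim3 p * qim2 q"
  "qim2 (p * q) = qre p * qim2 q - qim1 p * qim3 q + qim2 p * qre q + qim3 p * qim1 q"
  "qim3 (p * q) = qre p * qim3 q + qim1 p * qim2 q - qim2 p * qim1 q + qim3 p * qre q"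
  by (simp_all add: times_quat_def)

instantiation quat :: real_algebra_1
begin

definition "scaleR c q = Quat (c * qre q) (c * qim1 q) (c * qim2 q) (c * qim3 q)"

instance
  by standard (simp_all add: quat_eq_iff scaleR_quat_def quat_times_sel algebra_simps)

end

lemma quat_scaleR_sel [simp]:
  "qre (c *\<^sub>R q) = c * qre q" "qim1 (c *\<^sub>R q) = c * qim1 q"
  "qim2 (c *\<^sub>R q) = c * qim2 q" "qim3 (c *\<^sub>R q) = c * qim3 q"
  by (simp_all add: scaleR_quat_def)

instantiation quat :: real_inner
begin

definition inner_quat :: "quat \<Rightarrow> quat \<Rightarrow> real" where
  "inner_quat p q = qre p * qre q + qim1 p * qim1 q + qim2 p * qim2 q + qim3 p * qim3 q"

definition norm_quat :: "quat \<Rightarrow> real" where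
  "norm_quat q = sqrt ((qre q)\<^sup>2 + (qim1 q)\<^sup>2 + (qim2 q)\<^sup>2 + (qim3 q)\<^sup>2)"

definition sgn_quat :: "quat \<Rightarrow> quat" where
  "sgn_quat q = q /\<^sub>R norm q"

definition dist_quat :: "quat \<Rightarrow> quat \<Rightarrow> real" where
  "dist_quat p q = norm (p - q)"

definition uniformity_quat :: "(quat \<times> quat) filter" where
  "uniformity_quat = (INF e\<in>{0<..}. principal {(x, y). dist x y < e})"

definition open_quat :: "quat set \<Rightarrow> bool" where
  "open_quat U \<longleftrightarrow> (\<forall>x\<in>U. eventually (\<lambda>(x', y). x' = x \<longrightarrow> y \<in> U) uniformity)"

instance
proof
  fix x y z :: quat and r :: real and U :: "quat set"
  show "dist x y = norm (x - y)" by (simp add: dist_quat_def)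
  show "sgn x = x /\<^sub>R norm x" by (simp add: sgn_quat_def)
  show "uniformity = (INF e\<in>{0<..}. principal {(x, y). dist (x::quat) y < e})"
    by (simp add: uniformity_quat_def)
  show "open U \<longleftrightarrow> (\<forall>x\<in>U. eventually (\<lambda>(x', y). x' = x \<longrightarrow> y \<in> U) uniformity)"
    by (simp add: open_quat_def)
  show "inner x y = inner y x" by (simp add: inner_quat_def)
  show "inner (x + y) z = inner x z + inner y z" by (simp add: inner_quat_def algebra_simps)
  show "inner (r *\<^sub>R x) y = r * inner x y" by (simp add: inner_quat_def algebra_simps)
  show "0 \<le> inner x x" by (simp add: inner_quat_def)
  have sq: "0 \<le> qre x * qre x" "0 \<le> qim1 x * qim1 x" "0 \<le> qim2 x * qim2 x" "0 \<le> qim3 x * qim3 x"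
    by simp_all
  show "inner x x = 0 \<longleftrightarrow> x = 0"
  proof
    assume "inner x x = 0"
    then have "qre x * qre x = 0 \<and> qim1 x * qim1 x = 0 \<and> qim2 x * qim2 x = 0 \<and> qim3 x * qim3 x = 0"
      unfolding inner_quat_def using sq by linarith
    then show "x = 0" by (simp add: quat_eq_iff)
  qed (simp add: inner_quat_def)
  show "norm x = sqrt (inner x x)" by (simp add: norm_quat_def inner_quat_def power2_eq_square)
qed

end

lemma norm_quat_squared: "(norm q)\<^sup>2 = (qre q)\<^sup>2 + (qim1 q)\<^sup>2 + (qim2 q)\<^sup>2 + (qim3 q)\<^sup>2"
  for q :: quat
  by (simp add: norm_quat_def)

definition qcnj :: "quat \<Rightarrow> quat" where
  "qcnj q = Quat (qre q) (- qim1 q) (- qim2 q) (- qim3 q)"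

lemma qcnj_sel [simp]:
  "qre (qcnj q) = qre q" "qim1 (qcnj q) = - qim1 q"
  "qim2 (qcnj q) = - qim2 q" "qim3 (qcnj q) = - qim3 q"
  by (simp_all add: qcnj_def)

lemma quat_mult_qcnj: "q * qcnj q = (norm q)\<^sup>2 *\<^sub>R 1" "qcnj q * q = (norm q)\<^sup>2 *\<^sub>R 1"
  unfolding norm_quat_squared by (simp_all add: quat_eq_iff quat_times_sel power2_eq_square)

instantiation quat :: real_normed_div_algebra
begin

definition inverse_quat :: "quat \<Rightarrow> quat" where
  "inverse_quat q = qcnj q /\<^sub>R (norm q)\<^sup>2"

definition divide_quat :: "quat \<Rightarrow> quat \<Rightarrow> quat" where
  "divide_quat p q = p * inverse q"

instance
proof
  fix p q :: quat
  show "p \<noteq> 0 \<Longrightarrow> inverse p * p = 1" by (simp add: inverse_quat_def quat_mult_qcnj)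
  show "p \<noteq> 0 \<Longrightarrow> p * inverse p = 1" by (simp add: inverse_quat_def quat_mult_qcnj)
  show "p div q = p * inverse q" by (simp add: divide_quat_def)
  show "inverse (0::quat) = 0" by (simp add: inverse_quat_def)
  have "(norm (p * q))\<^sup>2 = (norm p * norm q)\<^sup>2"
    unfolding power_mult_distrib norm_quat_squared quat_times_sel
    by (simp add: power2_eq_square algebra_simps)
  then show "norm (p * q) = norm p * norm q"
    by (simp add: power2_eq_iff_nonneg)
qed

end

instantiation quat :: euclidean_space
begin

definition Basis_quat :: "quat set" where
  "Basis_quat = {Quat 1 0 0 0, Quat 0 1 0 0, Quat 0 0 1 0, Quat 0 0 0 1}"

instance
proof
  fix u v x :: quat
  show "(Basis :: quat set) \<noteq> {}" "finite (Basis :: quat set)"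
    by (simp_all add: Basis_quat_def)
  show "inner u v = (if u = v then 1 else 0)" if "u \<in> Basis" "v \<in> Basis"
    using that unfolding Basis_quat_def by (elim insertE emptyE) (simp_all add: inner_quat_def)
  show "(\<forall>u\<in>Basis. inner x u = 0) \<longleftrightarrow> x = 0"
    by (simp add: Basis_quat_def inner_quat_def quat_eq_iff[of x 0])
qed

end

definition imag_units :: "quat set" where
  "imag_units = {i. qre i = 0 \<and> norm i = 1}"

definition slice_point :: "quat \<Rightarrow> real \<Rightarrow> real \<Rightarrow> quat" where
  "slice_point i x y = of_real x + of_real y * i"

definition slice_plane :: "quat \<Rightarrow> quat set" where
  "slice_plane i = {slice_point i x y | x y. True}"

definition slice :: "quat set \<Rightarrow> quat \<Rightarrow> quat set" where
  "slice \<Omega> i = \<Omega> \<inter> slice_plane i"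

text \<open>
  A function \<open>\<Omega> \<rightarrow> \<bbbH>\<close> is represented by a total function that is \<open>undefined\<close> outside
  \<open>\<Omega>\<close> (\<open>extensional\<close>), so that equality of elements of these function spaces is
  equality on \<open>\<Omega>\<close>.  The set \<open>\<Omega>\<close> is meant to be open.
\<close>

definition slice_regular :: "quat set \<Rightarrow> (quat \<Rightarrow> quat) set" where
  "slice_regular \<Omega> = {f \<in> extensional \<Omega>. f differentiable_on \<Omega> \<and>
     (\<forall>i\<in>imag_units. \<forall>x y. slice_point i x y \<in> \<Omega> \<longrightarrow>
        vector_derivative (\<lambda>s. f (slice_point i s y)) (at x)
        + i * vector_derivative (\<lambda>t. f (slice_point i x t)) (at y) = 0)}"

text \<open>The area measure \<open>dx dy\<close> of \<open>\<complex>(j)\<close> is transported to the Borel sets of the quaternions.\<close>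

definition slice_measure :: "quat \<Rightarrow> quat measure" where
  "slice_measure j = distr (lborel :: (real \<times> real) measure) borel (\<lambda>(x, y). slice_point j x y)"

definition slice_bergman_space :: "quat set \<Rightarrow> quat \<Rightarrow> (quat \<Rightarrow> quat) set" where
  "slice_bergman_space \<Omega> j = {f \<in> slice_regular \<Omega>.
     (\<integral>\<^sup>+q\<in>slice \<Omega> j. ennreal ((norm (f q))\<^sup>2) \<partial>slice_measure j) < \<infinity>}"

definition slice_inner :: "quat set \<Rightarrow> quat \<Rightarrow> (quat \<Rightarrow> quat) \<Rightarrow> (quat \<Rightarrow> quat) \<Rightarrow> quat" where
  "slice_inner \<Omega> j f g = (LINT q:slice \<Omega> j|slice_measure j. qcnj (f q) * g q)"

text \<open>
  The inner product is right linear in its second argument, so the representing element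
  stands first.  Meaningful for \<open>q \<in> slice \<Omega> j\<close>; likewise the kernel below for
  \<open>q, r \<in> slice \<Omega> j\<close>.
\<close>

definition evaluation_representer :: "quat set \<Rightarrow> quat \<Rightarrow> quat \<Rightarrow> (quat \<Rightarrow> quat)" where
  "evaluation_representer \<Omega> j q = (THE k. k \<in> slice_bergman_space \<Omega> j \<and>
     (\<forall>f\<in>slice_bergman_space \<Omega> j. f q = slice_inner \<Omega> j k f))"

definition slice_bergman_kernel :: "quat set \<Rightarrow> quat \<Rightarrow> quat \<Rightarrow> quat \<Rightarrow> quat" where
  "slice_bergman_kernel \<Omega> j q r = qcnj (evaluation_representer \<Omega> j q r)"

text \<open>
  The slice Bergman kernel of the second kind.  The unit \<open>j\<close> with \<open>r \<in> slice \<Omega> j\<close> and the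
  representation \<open>q = x + y i\<close> are not unique (even for non-real \<open>q\<close> and \<open>r\<close> the units are
  determined only up to sign), so the value is specified as the one common to all
  admissible choices of \<open>j\<close>, \<open>i\<close>, \<open>x\<close> and \<open>y\<close>.
\<close>

definition bergman_kernel_second_kind :: "quat set \<Rightarrow> quat \<Rightarrow> quat \<Rightarrow> quat" where
  "bergman_kernel_second_kind \<Omega> q r = (THE v.
     \<forall>j\<in>imag_units. r \<in> slice \<Omega> j \<longrightarrow>
       (\<forall>i\<in>imag_units. \<forall>x y. q = slice_point i x y \<longrightarrow>
          v = (1/2) *\<^sub>R ((1 - i * j) * slice_bergman_kernel \<Omega> j (slice_point j x y) r)
            + (1/2) *\<^sub>R ((1 + i * j) * slice_bergman_kernel \<Omega> j (slice_point j x (- y)) r)))"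

end

theory Submission
  imports Defs "HOL-Complex_Analysis.Complex_Analysis"
begin

text \<open>
  On \<open>\<complex>(j)\<close> a slice regular function splits into holomorphic components, so the representer of
  evaluation at \<open>q\<close> restricts to the classical kernel \<open>(1 - w q\<^sup>*)\<^sup>-\<^sup>2 / \<pi>\<close> of the unit disc,
  and its slice regular extension is the asserted closed form with the two arguments exchanged.
  The classical reproducing property comes from averaging over rotations of the disc: by Cauchy's
  formula the mean of \<open>g(w) (1 - z w\<^sup>*)\<^sup>-\<^sup>2\<close> over a circle of radius \<open>\<rho>\<close> is \<open>(\<zeta> g(\<zeta>))'\<close> at
  \<open>\<zeta> = z \<rho>\<^sup>2\<close>, and \<open>\<rho>\<^sup>2\<close> is uniformly distributed, so that the fundamental theorem of
  calculus leaves \<open>\<pi> g(z)\<close>.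
  The closed form agrees with \<open>(1 - q r\<^sup>*)\<^sup>-\<^sup>2 / \<pi>\<close> when \<open>q\<close> and \<open>r\<close> share a slice, its
  denominator depends on \<open>q\<close> only through \<open>Re q\<close> and \<open>|q|\<close>, and its numerator is a
  polynomial in \<open>q\<^sup>*\<close> with coefficients on the right; hence it satisfies the representation formula
  in \<open>q\<close>, which is how the kernel of the second kind is built.
\<close>

section \<open>The Bergman kernel of the unit disc\<close>

text \<open>Area is a product measure on \<open>real \<times> real\<close>, which suits shears and
  Fubini, whereas holomorphy lives on \<open>complex\<close>; this map passes between the
  two.\<close>

definition pair_complex :: "real \<times> real \<Rightarrow> complex" where
  "pair_complex p = Complex (fst p) (snd p)"

lemma pair_complex_sel [simp]: "Re (pair_complex p) = fst p" "Im (pair_complex p) = snd p"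
  by (simp_all add: pair_complex_def)

lemma norm_pair_complex [simp]: "norm (pair_complex p) = norm p"
  by (cases p) (simp add: pair_complex_def norm_Pair complex_norm)

lemma continuous_on_pair_complex [continuous_intros]:
  "continuous_on S f \<Longrightarrow> continuous_on S (\<lambda>x. pair_complex (f x))"
  unfolding pair_complex_def complex_eq_iff Complex_eq by (intro continuous_intros)

section \<open>Invariance of planar Lebesgue measure under shears and rotations\<close>

definition rotate_pair :: "complex \<Rightarrow> real \<times> real \<Rightarrow> real \<times> real" where
  "rotate_pair u p = (Re (u * pair_complex p), Im (u * pair_complex p))"

lemma pair_complex_rotate [simp]: "pair_complex (rotate_pair u p) = u * pair_complex p"
  by (simp add: rotate_pair_def complex_eq_iff)

lemma rotate_pair_rotate: "rotate_pair u (rotate_pair v p) = rotate_pair (u * v) p"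
  unfolding rotate_pair_def[of u] rotate_pair_def[of "u * v"] by (simp add: mult.assoc)

lemma norm_rotate_pair: "norm (rotate_pair u p) = norm u * norm p"
  by (metis norm_mult norm_pair_complex pair_complex_rotate)

text \<open>By Fubini it is enough to integrate over \<open>x\<close> first: for fixed
  \<open>y\<close> the shear is the translation of the line by \<open>a * y\<close>.\<close>

lemma lborel_distr_shear:
  fixes a :: real
  shows "distr lborel borel (\<lambda>p. (fst p + a * snd p, snd p)) = (lborel :: (real \<times> real) measure)"
proof (rule measure_eqI)
  fix A :: "(real \<times> real) set"
  assume "A \<in> sets (distr lborel borel (\<lambda>p. (fst p + a * snd p, snd p)))"
  then have [measurable]: "A \<in> sets borel" by simp
  have m [measurable]: "(\<lambda>p. (fst p + a * snd p, snd p)) \<in> borel_measurable (borel :: (real \<times> real) measure)"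
    by (intro borel_measurable_continuous_onI continuous_intros)
  have mi: "(indicator A :: _ \<Rightarrow> ennreal) \<in> borel_measurable (borel \<Otimes>\<^sub>M borel)"
    by (simp add: borel_prod)
  have "emeasure (distr lborel borel (\<lambda>p. (fst p + a * snd p, snd p))) A
      = (\<integral>\<^sup>+p. indicator A p \<partial>distr lborel borel (\<lambda>p. (fst p + a * snd p, snd p)))"
    by simp
  also have "\<dots> = (\<integral>\<^sup>+p. indicator A (fst p + a * snd p, snd p) \<partial>(lborel \<Otimes>\<^sub>M lborel))"
    unfolding lborel_prod by (subst nn_integral_distr) auto
  also have "\<dots> = (\<integral>\<^sup>+y. \<integral>\<^sup>+x. indicator A (x + a * y, y) \<partial>lborel \<partial>lborel)"
    by (subst lborel_pair.nn_integral_snd[symmetric]) (use mi in \<open>auto simp: borel_prod lborel_prod\<close>)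
  also have "\<dots> = (\<integral>\<^sup>+y. \<integral>\<^sup>+x. indicator A (x, y) \<partial>lborel \<partial>lborel)"
  proof (rule nn_integral_cong)
    fix y :: real
    have "(\<lambda>x. indicator A (x, y) :: ennreal) \<in> borel_measurable borel"
      using mi by measurable
    from nn_integral_real_affine[OF this, of 1 "a * y"]
    show "(\<integral>\<^sup>+x. indicator A (x + a * y, y) \<partial>lborel) = (\<integral>\<^sup>+x. indicator A (x, y) \<partial>lborel)"
      by (simp add: add.commute)
  qed
  also have "\<dots> = (\<integral>\<^sup>+p. indicator A p \<partial>(lborel \<Otimes>\<^sub>M lborel))"
    by (subst lborel_pair.nn_integral_snd[symmetric]) (use mi in \<open>auto simp: borel_prod lborel_prod\<close>)
  also have "\<dots> = emeasure lborel A"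
    unfolding lborel_prod by simp
  finally show "emeasure (distr lborel borel (\<lambda>p. (fst p + a * snd p, snd p))) A = emeasure lborel A" .
qed simp

text \<open>Conjugating the horizontal shear with the exchange of coordinates gives the vertical
  one, and the exchange preserves the product measure.\<close>

lemma lborel_distr_shear':
  fixes a :: real
  shows "distr lborel borel (\<lambda>p. (fst p, snd p + a * fst p)) = (lborel :: (real \<times> real) measure)"
proof -
  have [measurable]: "(\<lambda>p. (fst p + a * snd p, snd p)) \<in> borel_measurable (borel :: (real \<times> real) measure)"
    "(\<lambda>p. (snd p, fst p)) \<in> borel_measurable (borel :: (real \<times> real) measure)"
    by (intro borel_measurable_continuous_onI continuous_intros)+
  have swap: "distr lborel borel (\<lambda>p. (snd p, fst p)) = (lborel :: (real \<times> real) measure)"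
  proof -
    have "distr lborel borel (\<lambda>p. (snd p, fst p)) = distr lborel lborel (\<lambda>p. (snd p, fst p) :: real \<times> real)"
      by (rule distr_cong) simp_all
    then show ?thesis
      using lborel_pair.distr_pair_swap[where 'a=real and 'b=real] unfolding lborel_prod case_prod_beta' by simp
  qed
  have "distr lborel borel (\<lambda>p. (fst p, snd p + a * fst p))
     = distr (distr (distr lborel borel (\<lambda>p. (snd p, fst p))) borel (\<lambda>p. (fst p + a * snd p, snd p)))
          borel (\<lambda>p. (snd p, fst p :: real))"
    by (subst distr_distr, simp, simp)+ (simp add: o_def)
  then show ?thesis
    by (simp only: swap lborel_distr_shear)
qed

lemma borel_measurable_rotate_pair [measurable]: "rotate_pair u \<in> borel_measurable borel"
  unfolding rotate_pair_def by (intro borel_measurable_continuous_onI continuous_intros)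

text \<open>A rotation by an angle other than \<pi> is a product of three shears, horizontal,
  vertical, horizontal, and each of them preserves the measure.\<close>

lemma lborel_distr_rotate_pair:
  assumes "norm u = 1"
  shows "distr lborel borel (rotate_pair u) = lborel"
proof -
  have main: "distr lborel borel (rotate_pair u) = lborel" if n: "norm u = 1" and "u \<noteq> -1" for u
  proof -
    let ?c = "Re u" and ?s = "Im u"
    have cs: "?c\<^sup>2 + ?s\<^sup>2 = 1" using n by (simp add: cmod_def)
    have c: "1 + ?c \<noteq> 0"
    proof
      assume "1 + ?c = 0"
      then have "?c = -1" by simp
      with cs have "?s = 0" by simp
      with \<open>?c = -1\<close> \<open>u \<noteq> -1\<close> show False by (simp add: complex_eq_iff)
    qed
    \<comment> \<open>For \<open>u\<close> of argument \<theta> this is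
      \<open>- tan (\<theta> / 2)\<close>, the coefficient of both horizontal shears; the vertical
      one has coefficient \<open>sin \<theta>\<close>.\<close>
    define t where "t = - (?s / (1 + ?c))"
    have "?s\<^sup>2 = (1 - ?c) * (1 + ?c)" using cs by (simp add: algebra_simps power2_eq_square)
    then have ts: "t * ?s = ?c - 1" using c by (simp add: t_def power2_eq_square divide_eq_eq)
    have tc: "t * (2 + t * ?s) = - ?s" unfolding ts using c by (simp add: t_def divide_simps)
    have [measurable]: "(\<lambda>p. (fst p + t * snd p, snd p)) \<in> borel_measurable (borel :: (real \<times> real) measure)"
      "(\<lambda>p. (fst p, snd p + ?s * fst p)) \<in> borel_measurable (borel :: (real \<times> real) measure)"
      by (intro borel_measurable_continuous_onI continuous_intros)+
    have rot: "rotate_pair u = (\<lambda>p. (fst p + t * snd p, snd p)) \<circ> (\<lambda>p. (fst p, snd p + ?s * fst p))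
        \<circ> (\<lambda>p. (fst p + t * snd p, snd p))"
    proof
      fix p :: "real \<times> real"
      obtain x y where p: "p = (x, y)" by (cases p)
      have 1: "(x + t * y) + t * (y + ?s * (x + t * y)) = x * (1 + t * ?s) + y * (t * (2 + t * ?s))"
        by (simp add: algebra_simps)
      have 2: "y + ?s * (x + t * y) = ?s * x + y * (1 + t * ?s)"
        by (simp add: algebra_simps)
      show "rotate_pair u p = ((\<lambda>p. (fst p + t * snd p, snd p)) \<circ> (\<lambda>p. (fst p, snd p + ?s * fst p))
        \<circ> (\<lambda>p. (fst p + t * snd p, snd p))) p"
        unfolding p o_def fst_conv snd_conv 1 unfolding 2 tc unfolding ts by (simp add: rotate_pair_def)
    qed
    have "distr lborel borel (rotate_pair u)
        = distr (distr (distr lborel borel (\<lambda>p. (fst p + t * snd p, snd p))) borel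
            (\<lambda>p. (fst p, snd p + ?s * fst p))) borel (\<lambda>p. (fst p + t * snd p, snd p))"
      unfolding rot by (subst distr_distr, simp, simp)+ (simp add: o_assoc)
    then show ?thesis by (simp only: lborel_distr_shear lborel_distr_shear')
  qed
  show ?thesis
  proof (cases "u = -1")
    case True
    \<comment> \<open>At angle \<pi> the half-angle tangent is infinite, so this rotation is taken
      as two quarter turns.\<close>
    have "rotate_pair u = rotate_pair \<i> \<circ> rotate_pair \<i>"
      by (rule ext) (simp add: True rotate_pair_rotate)
    moreover have "distr lborel borel (rotate_pair \<i>) = lborel"
      by (rule main) (auto simp: complex_eq_iff)
    ultimately show ?thesis
      using distr_distr[of "rotate_pair \<i>" borel borel "rotate_pair \<i>" lborel] by simp
  qed (use main assms in blast)
qed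

section \<open>Circular means and radial integrals over the disc\<close>

abbreviation unit_disc :: "(real \<times> real) set" where "unit_disc \<equiv> ball 0 1"

text \<open>Each rotated integrand has the same integral over the disc. Averaging over the angle
  \<open>t\<close> therefore changes nothing, and Fubini moves the average inside.\<close>

lemma integral_disc_circular_mean:
  fixes h :: "complex \<Rightarrow> complex"
  assumes int: "set_integrable lborel unit_disc (\<lambda>p. h (pair_complex p))"
  shows "(LINT p:unit_disc|lborel. h (pair_complex p)) =
    (LINT p:unit_disc|lborel. (LINT t:{0..1}|lborel. h (exp (2 * of_real pi * \<i> * of_real t) * pair_complex p)))"
proof -
  \<comment> \<open>Extension by zero to the whole plane, where the invariance of
    \<open>lborel\<close> applies directly.\<close>
  define H where "H p = indicator unit_disc p *\<^sub>R h (pair_complex p)" for p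
  define e where "e t = exp (2 * of_real pi * \<i> * of_real t)" for t :: real
  have ne: "norm (e t) = 1" for t by (simp add: e_def norm_exp_eq_Re)
  have H: "integrable lborel H" using int by (simp add: set_integrable_def H_def[abs_def])
  then have [measurable]: "H \<in> borel_measurable borel" by simp
  have rot: "integrable lborel (\<lambda>p. H (rotate_pair (e t) p))"
     "(\<integral>p. H (rotate_pair (e t) p) \<partial>lborel) = (\<integral>p. H p \<partial>lborel)"
     "(\<integral>p. norm (H (rotate_pair (e t) p)) \<partial>lborel) = (\<integral>p. norm (H p) \<partial>lborel)" for t
  proof -
    have d: "distr lborel borel (rotate_pair (e t)) = lborel" by (rule lborel_distr_rotate_pair[OF ne])
    show "integrable lborel (\<lambda>p. H (rotate_pair (e t) p))"
      using H by (subst (asm) d[symmetric], subst (asm) integrable_distr_eq) auto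
    show "(\<integral>p. H (rotate_pair (e t) p) \<partial>lborel) = (\<integral>p. H p \<partial>lborel)"
      by (subst (2) d[symmetric], subst integral_distr) auto
    show "(\<integral>p. norm (H (rotate_pair (e t) p)) \<partial>lborel) = (\<integral>p. norm (H p) \<partial>lborel)"
      by (subst (2) d[symmetric], subst integral_distr) auto
  qed
  define G where "G t p = indicator {0..1} t *\<^sub>R H (rotate_pair (e t) p)" for t :: real and p
  have [measurable]: "(\<lambda>x. rotate_pair (e (fst x)) (snd x)) \<in> borel_measurable (borel :: (real \<times> real \<times> real) measure)"
    unfolding rotate_pair_def e_def
    by (intro borel_measurable_continuous_onI continuous_intros)
  have [measurable]: "(\<lambda>x. rotate_pair (e (fst x)) (snd x)) \<in> (lborel :: real measure) \<Otimes>\<^sub>M (lborel :: (real \<times> real) measure) \<rightarrow>\<^sub>M borel"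
    by (simp add: lborel_prod)
  have Gm: "case_prod G \<in> borel_measurable (lborel \<Otimes>\<^sub>M lborel)"
    unfolding G_def case_prod_beta' by measurable
  \<comment> \<open>Absolute integrability is immediate, because the integral of the norm over the
    plane does not depend on \<open>t\<close>.\<close>
  have Gint: "integrable (lborel \<Otimes>\<^sub>M lborel) (case_prod G)"
  proof (rule lborel_pair.Fubini_integrable[OF Gm])
    have "integrable lborel (\<lambda>t. indicator {0..1::real} t *\<^sub>R (\<integral>p. norm (H p) \<partial>lborel))"
      by simp
    also have "(\<lambda>t. indicator {0..1::real} t *\<^sub>R (\<integral>p. norm (H p) \<partial>lborel)) = (\<lambda>t. \<integral>p. norm (G t p) \<partial>lborel)"
      by (simp add: G_def rot)
    finally show "integrable lborel (\<lambda>t. \<integral>p. norm (case_prod G (t, p)) \<partial>lborel)"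
      by simp
    show "AE t in lborel. integrable lborel (\<lambda>p. case_prod G (t, p))"
      by (simp add: G_def rot)
  qed
  have "(LINT p:unit_disc|lborel. h (pair_complex p)) = (\<integral>t. indicator {0..1::real} t *\<^sub>R (\<integral>p. H p \<partial>lborel) \<partial>lborel)"
    by (simp add: H_def set_lebesgue_integral_def)
  also have "\<dots> = (\<integral>t. (\<integral>p. G t p \<partial>lborel) \<partial>lborel)"
    by (simp add: G_def rot)
  also have "\<dots> = (\<integral>p. (\<integral>t. G t p \<partial>lborel) \<partial>lborel)"
    using lborel_pair.Fubini_integral[OF Gint] by simp
  also have "\<dots> = (LINT p:unit_disc|lborel. (LINT t:{0..1}|lborel. h (e t * pair_complex p)))"
  proof -
    have "indicator unit_disc (rotate_pair (e t) p) = (indicator unit_disc p :: real)" for t p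
      by (simp add: indicator_def norm_rotate_pair ne)
    then show ?thesis
      unfolding set_lebesgue_integral_def G_def H_def
      by (intro Bochner_Integration.integral_cong refl) (auto simp: indicator_def)
  qed
  finally show ?thesis by (simp add: e_def)
qed

text \<open>The points of the disc with squared radius above \<open>x\<close> form an annulus of
  area \<open>pi * (1 - x)\<close> for \<open>x\<close> in \<open>{0..1}\<close>, which is linear in
  \<open>x\<close>. Finite values on the half-lines \<open>{x<..}\<close> determine the
  measure.\<close>

lemma distr_norm_sq_unit_disc:
  "distr (restrict_space lborel unit_disc) borel (\<lambda>p. (norm p)\<^sup>2) =
    density lborel (\<lambda>s. ennreal (pi * indicator {0..1} s))"
proof (rule measure_eqI_lessThan)
  have m: "(\<lambda>p. (norm p)\<^sup>2) \<in> borel_measurable (restrict_space lborel unit_disc)"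
    by (intro measurable_restrict_space1) simp
  have L: "emeasure (distr (restrict_space lborel unit_disc) borel (\<lambda>p. (norm p)\<^sup>2)) {x<..}
      = emeasure lborel {p \<in> unit_disc. x < (norm p)\<^sup>2}" for x
    by (subst emeasure_distr[OF m], simp, subst emeasure_restrict_space)
      (auto simp: space_restrict_space intro!: arg_cong[where f="emeasure lborel"])
  have area: "emeasure lborel (ball (0 :: real \<times> real) r) = ennreal (pi * r\<^sup>2)"
    "emeasure lborel (cball (0 :: real \<times> real) r) = ennreal (pi * r\<^sup>2)" if "r \<ge> 0" for r
    using that by (simp_all add: emeasure_ball emeasure_cball unit_ball_vol_2 power2_eq_square)
  \<comment> \<open>Clamping \<open>x\<close> to the unit interval covers the full disc for
    \<open>x < 0\<close> and the empty set for \<open>x \<ge> 1\<close>.\<close>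
  have val: "emeasure lborel {p \<in> unit_disc. x < (norm p)\<^sup>2} = ennreal (pi * (1 - max 0 (min 1 x)))" for x
  proof (cases "x < 0")
    case True
    then have "{p \<in> unit_disc. x < (norm p)\<^sup>2} = unit_disc"
      by (auto intro: less_le_trans)
    with True show ?thesis using area(1)[of 1] by simp
  next
    case False
    show ?thesis
    proof (cases "x < 1")
      case True
      with False have "sqrt x < 1" by simp
      have "{p \<in> unit_disc. x < (norm p)\<^sup>2} = unit_disc - cball 0 (sqrt x)"
      proof -
        have "x < (norm p)\<^sup>2 \<longleftrightarrow> sqrt x < norm p" for p :: "real \<times> real"
          using real_sqrt_less_iff[of x "(norm p)\<^sup>2"] by simp
        then show ?thesis by (auto simp: not_less)
      qed
      also have "emeasure lborel \<dots> = emeasure lborel unit_disc - emeasure lborel (cball (0 :: real \<times> real) (sqrt x))"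
        using False by (intro emeasure_Diff) (auto simp: area intro: le_less_trans[OF _ \<open>sqrt x < 1\<close>])
      also have "\<dots> = ennreal (pi * (1 - x))"
        using False by (simp add: area ennreal_minus algebra_simps)
      finally show ?thesis using True False by simp
    next
      case False
      have "(norm p)\<^sup>2 < 1" if "p \<in> unit_disc" for p :: "real \<times> real"
        using that by (simp add: power_less_one_iff)
      with False have E: "{p \<in> unit_disc. x < (norm p)\<^sup>2} = {}" by force
      show ?thesis unfolding E using False by simp
    qed
  qed
  show "emeasure (distr (restrict_space lborel unit_disc) borel (\<lambda>p. (norm p)\<^sup>2)) {x<..} < \<infinity>" for x
    unfolding L val by simp
  show "emeasure (distr (restrict_space lborel unit_disc) borel (\<lambda>p. (norm p)\<^sup>2)) {x<..}
      = emeasure (density lborel (\<lambda>s. ennreal (pi * indicator {0..1} s))) {x<..}" for x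
  proof -
    have "emeasure (density lborel (\<lambda>s. ennreal (pi * indicator {0..1} s))) {x<..}
       = (\<integral>\<^sup>+s. ennreal pi * indicator ({0..1} \<inter> {x<..}) s \<partial>lborel)"
      by (subst emeasure_density) (auto intro!: nn_integral_cong simp: indicator_def)
    also have "\<dots> = ennreal pi * emeasure lborel ({0..1} \<inter> {x<..})"
      by (rule nn_integral_cmult_indicator) simp
    also have "emeasure lborel ({0..1} \<inter> {x<..}) = ennreal (1 - max 0 (min 1 x))"
    proof (cases "x < 0")
      case True
      then have "{0..1} \<inter> {x<..} = {0..1}" by auto
      with True show ?thesis by simp
    next
      case False
      then have "{0..1} \<inter> {x<..} = {x<..1}" by auto
      with False show ?thesis by (cases "x \<le> 1") auto
    qed
    finally show ?thesis unfolding L val by (simp add: ennreal_mult)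
  qed
qed simp_all

text \<open>Polar coordinates for a radial integrand, with the squared radius as variable so that no
  Jacobian factor is left.\<close>

lemma integral_disc_radial:
  fixes f :: "real \<Rightarrow> complex"
  assumes [measurable]: "f \<in> borel_measurable borel"
  shows "(LINT p:unit_disc|lborel. f ((norm p)\<^sup>2)) = of_real pi * (LINT s:{0..1}|lborel. f s)"
proof -
  have m: "(\<lambda>p. (norm p)\<^sup>2) \<in> borel_measurable (restrict_space lborel unit_disc)"
    by (intro measurable_restrict_space1) simp
  have "(LINT p:unit_disc|lborel. f ((norm p)\<^sup>2)) = (\<integral>p. f ((norm p)\<^sup>2) \<partial>restrict_space lborel unit_disc)"
    by (subst integral_restrict_space) (auto simp: set_lebesgue_integral_def)
  also have "\<dots> = (\<integral>s. f s \<partial>distr (restrict_space lborel unit_disc) borel (\<lambda>p. (norm p)\<^sup>2))"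
    using m by (subst integral_distr) auto
  also have "\<dots> = (\<integral>s. (pi * indicator {0..1} s) *\<^sub>R f s \<partial>lborel)"
    unfolding distr_norm_sq_unit_disc by (subst integral_density) auto
  also have "\<dots> = (\<integral>s. of_real pi * (indicator {0..1} s *\<^sub>R f s) \<partial>lborel)"
    by (simp add: scaleR_conv_of_real mult_ac)
  finally show ?thesis by (simp only: set_lebesgue_integral_def integral_mult_right_zero)
qed

text \<open>On the unit circle \<open>cnj u = 1 / u\<close>, so the kernel becomes
  \<open>u\<^sup>2 / (u - a)\<^sup>2\<close> with \<open>a = z * cnj w\<close>. Since
  \<open>du = 2 \<pi> \<i> u dt\<close>, the mean is Cauchy's integral for the derivative at
  \<open>a\<close> of \<open>F u = u * g (u * w)\<close>.\<close>

lemma circular_mean_bergman: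
  fixes g :: "complex \<Rightarrow> complex"
  assumes g: "g holomorphic_on ball 0 1" and z: "norm z < 1" and w: "norm w < 1"
  defines "e \<equiv> \<lambda>t::real. exp (2 * of_real pi * \<i> * of_real t)"
  shows "(LINT t:{0..1}|lborel. g (e t * w) / (1 - z * cnj (e t * w))\<^sup>2)
     = g (z * of_real ((norm w)\<^sup>2)) + z * of_real ((norm w)\<^sup>2) * deriv g (z * of_real ((norm w)\<^sup>2))"
proof -
  define F where "F u = u * g (u * w)" for u
  define a where "a = z * cnj w"
  have aw: "a * w = z * of_real ((norm w)\<^sup>2)"
    by (simp only: a_def complex_norm_square mult_ac)
  have na: "norm a < 1"
    using z w mult_left_le[of "norm w" "norm z"] by (simp add: a_def norm_mult)
  have in1: "u * w \<in> ball 0 1" if "norm u \<le> 1" for u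
  proof -
    have "norm u * norm w \<le> norm w" using that by (simp add: mult_left_le_one_le)
    then show ?thesis using w by (simp add: norm_mult)
  qed
  \<comment> \<open>The closed disc is allowed because \<open>norm w < 1\<close> keeps
    \<open>u * w\<close> inside the open disc even for \<open>norm u = 1\<close>.\<close>
  have holF: "F holomorphic_on cball 0 1"
    unfolding F_def
    by (intro holomorphic_intros holomorphic_on_compose_gen[OF _ g, unfolded o_def])
      (use in1 in auto)
  have e1: "norm (e t) = 1" for t by (simp add: e_def norm_exp_eq_Re)
  have "((\<lambda>u. F u / (u - a)\<^sup>2) has_contour_integral (2 * of_real pi * \<i> * deriv F a)) (circlepath 0 1)"
  proof -
    have 1: "continuous_on (cball 0 1) F" "F holomorphic_on ball 0 1" "a \<in> ball 0 1"
      using holF na by (auto intro: holomorphic_on_imp_continuous_on holomorphic_on_subset)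
    show ?thesis
      using has_contour_integral_integral[OF Cauchy_derivative_integral_circlepath(1)[OF 1]]
      unfolding Cauchy_contour_integral_circlepath_2[OF 1] by simp
  qed
  then have hc: "((\<lambda>t. F (e t) / (e t - a)\<^sup>2 * (2 * of_real pi * \<i> * e t)) has_integral
      (2 * of_real pi * \<i> * deriv F a)) {0..1}"
    unfolding has_contour_integral vector_derivative_circlepath by (simp add: circlepath e_def mult_ac)
  have ea: "e t - a \<noteq> 0" for t using e1[of t] na by auto
  have kern: "1 - z * cnj (e t * w) = (e t - a) / e t" for t
  proof -
    have "e t * cnj (e t) = 1" by (simp add: e1 flip: complex_norm_square)
    moreover have "e t \<noteq> 0" using e1[of t] by auto
    ultimately have "cnj (e t) = 1 / e t" by (simp add: field_simps)
    then have "z * cnj (e t * w) = a * (1 / e t)" by (simp only: complex_cnj_mult a_def mult_ac)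
    with \<open>e t \<noteq> 0\<close> show ?thesis by (simp add: diff_divide_distrib)
  qed
  have I: "((\<lambda>t. inverse (2 * of_real pi * \<i>) * (F (e t) / (e t - a)\<^sup>2 * (2 * of_real pi * \<i> * e t))) has_integral
      inverse (2 * of_real pi * \<i>) * (2 * of_real pi * \<i> * deriv F a)) {0..1}"
    by (rule has_integral_mult_right[OF hc])
  have K: "inverse (2 * of_real pi * \<i>) * (F (e t) / (e t - a)\<^sup>2 * (2 * of_real pi * \<i> * e t))
      = g (e t * w) / (1 - z * cnj (e t * w))\<^sup>2" for t
  proof -
    have cancel: "inverse c * (A / B * (c * u)) = A * u / B" if "c \<noteq> 0" for c A B u :: complex
      using that by (simp add: field_simps)
    have "inverse (2 * of_real pi * \<i>) * (F (e t) / (e t - a)\<^sup>2 * (2 * of_real pi * \<i> * e t))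
      = F (e t) * e t / (e t - a)\<^sup>2" by (rule cancel) simp
    also have "\<dots> = g (e t * w) / ((e t - a) / e t)\<^sup>2"
      by (simp add: F_def power2_eq_square)
    finally show ?thesis unfolding kern .
  qed
  have hi: "((\<lambda>t. g (e t * w) / (1 - z * cnj (e t * w))\<^sup>2) has_integral deriv F a) {0..1}"
  proof -
    have cancel: "inverse c * (c * x) = x" if "c \<noteq> 0" for c x :: complex
      using that by simp
    have "inverse (2 * of_real pi * \<i>) * (2 * of_real pi * \<i> * deriv F a) = deriv F a"
      by (rule cancel) simp
    then show ?thesis using I by (simp only: K)
  qed
  have conte: "continuous_on S e" for S unfolding e_def by (intro continuous_intros)
  have contg: "continuous_on (ball 0 1) g" using g by (rule holomorphic_on_imp_continuous_on)
  have cont: "continuous_on {0..1} (\<lambda>t. g (e t * w) / (1 - z * cnj (e t * w))\<^sup>2)"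
  proof -
    have "1 - z * cnj (e t * w) \<noteq> 0" for t
      unfolding kern using ea[of t] e1[of t] by auto
    then show ?thesis
      using in1 e1 by (intro continuous_intros conte continuous_on_compose2[OF contg]) auto
  qed
  have "(LINT t:{0..1}|lborel. g (e t * w) / (1 - z * cnj (e t * w))\<^sup>2) = deriv F a"
    using set_borel_integral_eq_integral(2)[OF borel_integrable_atLeastAtMost'[OF cont]] hi
    by (simp add: integral_unique)
  also have "deriv F a = g (a * w) + a * w * deriv g (a * w)"
  proof (rule DERIV_imp_deriv)
    have "(g has_field_derivative deriv g (a * w)) (at (a * w))"
      using in1[of a] na by (intro holomorphic_derivI[OF g]) auto
    then have "((\<lambda>u. g (u * w)) has_field_derivative deriv g (a * w) * w) (at a)"
      by (rule DERIV_chain2) (auto intro!: derivative_eq_intros)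
    then show "(F has_field_derivative g (a * w) + a * w * deriv g (a * w)) (at a)"
      unfolding F_def by (auto intro!: derivative_eq_intros simp: algebra_simps)
  qed
  finally show ?thesis by (simp add: aw)
qed


text \<open>Integrability of \<open>g\<close> is all that the averaging argument needs: for fixed
  \<open>z\<close> the kernel factor is bounded on the disc.\<close>

lemma bergman_reproducing:
  fixes g :: "complex \<Rightarrow> complex"
  assumes g: "g holomorphic_on ball 0 1" and z: "norm z < 1"
    and int: "set_integrable lborel unit_disc (\<lambda>p. g (pair_complex p))"
  shows "(LINT p:unit_disc|lborel. g (pair_complex p) / (1 - z * cnj (pair_complex p))\<^sup>2) = of_real pi * g z"
proof -
  define h where "h w = g w / (1 - z * cnj w)\<^sup>2" for w
  have low: "1 - norm z \<le> norm (1 - z * cnj w)" if "norm w < 1" for w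
  proof -
    have "norm (z * cnj w) \<le> norm z" using that by (simp add: norm_mult mult_left_le)
    then show ?thesis using norm_triangle_ineq2[of 1 "z * cnj w"] by simp
  qed
  have "continuous_on (ball 0 1) h"
    unfolding h_def using holomorphic_on_imp_continuous_on[OF g] low z
    by (intro continuous_intros) (auto, force)
  then have conth: "continuous_on unit_disc (\<lambda>p. h (pair_complex p))"
    by (rule continuous_on_compose2) (auto intro!: continuous_intros)
  have inth: "set_integrable lborel unit_disc (\<lambda>p. h (pair_complex p))"
    unfolding set_integrable_def
  proof (rule Bochner_Integration.integrable_bound)
    show "integrable lborel (\<lambda>p. (indicator unit_disc p *\<^sub>R g (pair_complex p)) /\<^sub>R (1 - norm z)\<^sup>2)"
      using int unfolding set_integrable_def by (intro integrable_scaleR_right)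
    show "(\<lambda>p. indicator unit_disc p *\<^sub>R h (pair_complex p)) \<in> borel_measurable lborel"
      using borel_measurable_continuous_on_indicator[OF _ conth] by simp
    show "AE p in lborel. norm (indicator unit_disc p *\<^sub>R h (pair_complex p))
        \<le> norm ((indicator unit_disc p *\<^sub>R g (pair_complex p)) /\<^sub>R (1 - norm z)\<^sup>2)"
    proof (intro AE_I2)
      fix p :: "real \<times> real"
      show "norm (indicator unit_disc p *\<^sub>R h (pair_complex p))
        \<le> norm ((indicator unit_disc p *\<^sub>R g (pair_complex p)) /\<^sub>R (1 - norm z)\<^sup>2)"
      proof (cases "p \<in> unit_disc")
        case True
        then have "(1 - norm z)\<^sup>2 \<le> (norm (1 - z * cnj (pair_complex p)))\<^sup>2"
          using low[of "pair_complex p"] z by (intro power_mono) auto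
        moreover have "0 < (1 - norm z)\<^sup>2" using z by simp
        ultimately have "norm (g (pair_complex p)) / (norm (1 - z * cnj (pair_complex p)))\<^sup>2
           \<le> norm (g (pair_complex p)) / (1 - norm z)\<^sup>2"
          by (intro divide_left_mono mult_pos_pos less_le_trans[OF \<open>0 < (1 - norm z)\<^sup>2\<close>]) auto
        then show ?thesis using True z by (simp add: h_def norm_mult norm_inverse norm_power divide_inverse mult.commute)
      qed simp
    qed
  qed
  \<comment> \<open>The circular mean at squared radius \<open>s\<close>, which is the derivative of
    \<open>s * g (z * s)\<close> with respect to \<open>s\<close>.\<close>
  define f where "f s = g (z * of_real s) + z * of_real s * deriv g (z * of_real s)" for s :: real
  have zs: "z * of_real s \<in> ball 0 1" if "s \<in> {0..1}" for s
    using that z by (auto simp: norm_mult intro: le_less_trans[OF mult_left_le])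
  have der: "((\<lambda>s. of_real s * g (z * of_real s)) has_vector_derivative f s) (at s within {0..1})"
    if "s \<in> {0..1}" for s
  proof -
    have "(g has_field_derivative deriv g (z * of_real s)) (at (z * of_real s))"
      using zs[OF that] by (intro holomorphic_derivI[OF g]) auto
    then have "((\<lambda>u. g (z * u)) has_field_derivative deriv g (z * of_real s) * z) (at (of_real s))"
      by (rule DERIV_chain2) (auto intro!: derivative_eq_intros)
    then have "((\<lambda>u. u * g (z * u)) has_field_derivative f s) (at (of_real s))"
      unfolding f_def by (auto intro!: derivative_eq_intros simp: algebra_simps)
    then show ?thesis
      by (rule has_vector_derivative_real_field[THEN has_vector_derivative_at_within])
  qed
  have contf: "continuous_on {0..1} f"
    unfolding f_def using zs
    by (intro continuous_intros continuous_on_compose2[OF holomorphic_on_imp_continuous_on[OF g]]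
          continuous_on_compose2[OF holomorphic_on_imp_continuous_on[OF holomorphic_deriv[OF g]]]) auto
  \<comment> \<open>\<open>f\<close> is controlled only on \<open>{0..1}\<close>; cutting it off
    gives a function measurable on the whole line, as \<open>integral_disc_radial\<close>
    requires.\<close>
  define f' where "f' s = indicator {0..1} s *\<^sub>R f s" for s
  have f'm: "f' \<in> borel_measurable borel"
    unfolding f'_def using borel_measurable_continuous_on_indicator[OF _ contf] by simp
  have "(LINT p:unit_disc|lborel. h (pair_complex p)) = (LINT p:unit_disc|lborel. f' ((norm p)\<^sup>2))"
    unfolding integral_disc_circular_mean[OF inth]
  proof (rule set_lebesgue_integral_cong)
    show "\<forall>p. p \<in> unit_disc \<longrightarrow> (LINT t:{0..1}|lborel. h (exp (2 * of_real pi * \<i> * of_real t) * pair_complex p))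
       = f' ((norm p)\<^sup>2)"
      using circular_mean_bergman[OF g z]
      by (auto simp: h_def f'_def f_def abs_square_le_1 less_imp_le)
  qed simp
  also have "\<dots> = of_real pi * (LINT s:{0..1}|lborel. f' s)"
    by (rule integral_disc_radial[OF f'm])
  also have "(LINT s:{0..1}|lborel. f' s) = (LINT s:{0..1}|lborel. f s)"
    by (intro set_lebesgue_integral_cong) (auto simp: f'_def)
  \<comment> \<open>The primitive \<open>s * g (z * s)\<close> vanishes at \<open>0\<close> and
    equals \<open>g z\<close> at \<open>1\<close>.\<close>
  also have "\<dots> = g z"
    using integral_FTC_atLeastAtMost[OF _ der contf] by (simp add: set_lebesgue_integral_def)
  finally show ?thesis by (simp add: h_def)
qed

section \<open>Slices and their coordinates\<close>

lemma slice_point_sel [simp]: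
  "qre (slice_point j x y) = x + y * qre j" "qim1 (slice_point j x y) = y * qim1 j"
  "qim2 (slice_point j x y) = y * qim2 j" "qim3 (slice_point j x y) = y * qim3 j"
  by (simp_all add: slice_point_def of_real_def)

lemma imag_unitsD:
  assumes "j \<in> imag_units"
  shows "qre j = 0" "(qim1 j)\<^sup>2 + (qim2 j)\<^sup>2 + (qim3 j)\<^sup>2 = 1" "norm j = 1" "j * j = -1" "qcnj j = - j"
proof -
  show 1: "qre j = 0" "norm j = 1" using assms by (auto simp: imag_units_def)
  then show 2: "(qim1 j)\<^sup>2 + (qim2 j)\<^sup>2 + (qim3 j)\<^sup>2 = 1" using norm_quat_squared[of j] by simp
  show "j * j = -1" using 1 2 by (simp add: quat_eq_iff quat_times_sel power2_eq_square)
  show "qcnj j = - j" using 1 by (simp add: quat_eq_iff)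
qed

text \<open>For an imaginary unit \<open>j\<close> this is the field isomorphism of
  \<open>complex\<close> onto the slice plane of \<open>j\<close>; identities within one slice are
  proved in \<open>complex\<close> and transported.\<close>

definition slice_embed :: "quat \<Rightarrow> complex \<Rightarrow> quat" where
  "slice_embed j z = slice_point j (Re z) (Im z)"

lemma slice_embed_alt: "slice_embed j z = Re z *\<^sub>R 1 + Im z *\<^sub>R j"
  by (simp add: slice_embed_def slice_point_def of_real_def)

lemma slice_point_eq_embed: "slice_point j x y = slice_embed j (Complex x y)"
  by (simp add: slice_embed_def)

lemma bounded_linear_slice_embed: "bounded_linear (slice_embed j)"
  unfolding slice_embed_alt[abs_def]
  by (intro bounded_linear_add bounded_linear_scaleR_const bounded_linear_Re bounded_linear_Im)

lemma slice_embed_add: "slice_embed j (z + w) = slice_embed j z + slice_embed j w"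
  and slice_embed_diff: "slice_embed j (z - w) = slice_embed j z - slice_embed j w"
  and slice_embed_of_real: "slice_embed j (of_real x) = of_real x"
  and slice_embed_1: "slice_embed j 1 = 1"
  and slice_embed_scaleR: "slice_embed j (x *\<^sub>R z) = x *\<^sub>R slice_embed j z"
  by (simp_all add: slice_embed_alt algebra_simps of_real_def)

lemma slice_embed_numeral: "slice_embed j (numeral n) = numeral n"
  using slice_embed_of_real[of j "numeral n"] by simp

context
  fixes j :: quat
  assumes j: "j \<in> imag_units"
begin

lemma slice_embed_mult: "slice_embed j (z * w) = slice_embed j z * slice_embed j w"
  by (simp add: slice_embed_alt algebra_simps imag_unitsD[OF j])

lemma norm_slice_embed: "norm (slice_embed j z) = norm z"
proof -
  have "(norm (slice_embed j z))\<^sup>2 = (Re z)\<^sup>2 + (Im z)\<^sup>2 * ((qim1 j)\<^sup>2 + (qim2 j)\<^sup>2 + (qim3 j)\<^sup>2)"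
    unfolding norm_quat_squared
    by (simp add: slice_embed_def imag_unitsD(1)[OF j] power_mult_distrib distrib_left)
  then have "(norm (slice_embed j z))\<^sup>2 = (norm z)\<^sup>2"
    unfolding imag_unitsD(2)[OF j] cmod_power2 by simp
  then show ?thesis by (simp add: power2_eq_iff_nonneg)
qed

lemma qcnj_slice_embed: "qcnj (slice_embed j z) = slice_embed j (cnj z)"
  by (simp add: quat_eq_iff slice_embed_def imag_unitsD[OF j])

lemma qre_slice_embed: "qre (slice_embed j z) = Re z"
  by (simp add: slice_embed_def imag_unitsD[OF j])

lemma slice_embed_power: "slice_embed j (z ^ n) = slice_embed j z ^ n"
  by (induction n) (simp_all add: slice_embed_mult slice_embed_1)

lemma slice_embed_inverse: "slice_embed j (inverse z) = inverse (slice_embed j z)"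
proof (cases "z = 0")
  case True
  then show ?thesis by (simp add: slice_embed_alt)
next
  case False
  then have "slice_embed j z * slice_embed j (inverse z) = 1"
    by (simp add: slice_embed_mult[symmetric] slice_embed_1)
  then show ?thesis by (simp add: inverse_unique)
qed

end

text \<open>The unit is the normalised imaginary part; for real \<open>q\<close> any unit serves,
  and one is fixed arbitrarily.\<close>

lemma quat_slice_cases:
  obtains i x y where "i \<in> imag_units" "q = slice_point i x y"
proof -
  define n where "n = sqrt ((qim1 q)\<^sup>2 + (qim2 q)\<^sup>2 + (qim3 q)\<^sup>2)"
  show thesis
  proof (cases "n = 0")
    case True
    then have "(qim1 q)\<^sup>2 + (qim2 q)\<^sup>2 + (qim3 q)\<^sup>2 = 0" by (simp add: n_def)
    then have "qim1 q = 0" "qim2 q = 0" "qim3 q = 0"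
      by (smt (verit) zero_le_power2 power2_eq_iff zero_eq_power2)+
    then have "q = slice_point (Quat 0 1 0 0) (qre q) 0" by (simp add: quat_eq_iff)
    moreover have "Quat 0 1 0 0 \<in> imag_units" by (simp add: imag_units_def norm_quat_def)
    ultimately show thesis using that by blast
  next
    case False
    define i where "i = Quat 0 (qim1 q / n) (qim2 q / n) (qim3 q / n)"
    have n2: "n\<^sup>2 = (qim1 q)\<^sup>2 + (qim2 q)\<^sup>2 + (qim3 q)\<^sup>2" by (simp add: n_def)
    have "(norm i)\<^sup>2 = 1"
      unfolding norm_quat_squared using False
      by (simp add: i_def power_divide add_divide_distrib[symmetric] n2[symmetric])
    then have "i \<in> imag_units"
      by (simp add: imag_units_def i_def power2_eq_1_iff) (smt (verit) norm_ge_zero)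
    moreover have "q = slice_point i (qre q) n" using False by (simp add: quat_eq_iff i_def)
    ultimately show thesis using that by blast
  qed
qed

lemma slice_eq: "slice (ball 0 1) j = ball 0 1 \<inter> range (slice_embed j)"
proof -
  have "slice_plane j = range (slice_embed j)"
  proof (intro set_eqI iffI)
    fix p
    show "p \<in> slice_plane j \<Longrightarrow> p \<in> range (slice_embed j)"
      unfolding slice_plane_def by (auto simp: slice_point_eq_embed)
    show "p \<in> range (slice_embed j) \<Longrightarrow> p \<in> slice_plane j"
      unfolding slice_plane_def slice_embed_def by blast
  qed
  then show ?thesis by (simp add: slice_def)
qed

text \<open>The splitting of the quaternions over \<open>\<complex>(j)\<close> is encoded by the
  \<open>\<complex>(j)\<close>-linear functionals \<open>p \<mapsto> slice_coord j (p * a)\<close>, which jointly separate points.\<close>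

definition slice_coord :: "quat \<Rightarrow> quat \<Rightarrow> complex" where
  "slice_coord j p = Complex (qre p) (- qre (j * p))"

lemma bounded_linear_qre: "bounded_linear qre"
proof -
  have "qre = inner 1" by (rule ext) (simp add: inner_quat_def)
  then show ?thesis using bounded_linear_inner_right[of "1 :: quat"] by simp
qed

lemma bounded_linear_qcnj: "bounded_linear qcnj"
proof
  show "\<exists>K. \<forall>x. norm (qcnj x) \<le> norm x * K"
    by (rule exI[of _ 1]) (simp add: norm_quat_def)
qed (simp_all add: quat_eq_iff)

lemma norm_qcnj [simp]: "norm (qcnj q) = norm q"
  by (simp add: norm_quat_def)

lemma qcnj_mult: "qcnj (p * q) = qcnj q * qcnj p"
  by (simp add: quat_eq_iff quat_times_sel)

lemma qcnj_qcnj [simp]: "qcnj (qcnj q) = q"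
  by (simp add: quat_eq_iff)

lemma bounded_linear_slice_coord: "bounded_linear (\<lambda>p. slice_coord j (p * a))"
proof -
  have "bounded_linear (\<lambda>p. of_real (qre (p * a)) - \<i> * of_real (qre (j * (p * a))))"
    by (intro bounded_linear_sub bounded_linear_of_real[THEN bounded_linear_compose]
        bounded_linear_qre[THEN bounded_linear_compose] bounded_linear_mult_left bounded_linear_mult_right
        bounded_linear_mult_right[THEN bounded_linear_compose])
  also have "(\<lambda>p. of_real (qre (p * a)) - \<i> * of_real (qre (j * (p * a)))) = (\<lambda>p. slice_coord j (p * a))"
    by (simp add: slice_coord_def complex_eq_iff fun_eq_iff)
  finally show ?thesis .
qed

lemma slice_coord_mult:
  assumes "j \<in> imag_units"
  shows "slice_coord j (slice_embed j z * p) = z * slice_coord j p"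
proof -
  have "j * (j * p) = - p" by (simp add: mult.assoc[symmetric] imag_unitsD[OF assms])
  then show ?thesis
    by (simp add: slice_coord_def complex_eq_iff slice_embed_alt algebra_simps)
qed

text \<open>The choice \<open>a = qcnj (p - q)\<close> turns the difference of the real parts into
  \<open>(norm (p - q))\<^sup>2\<close>.\<close>

lemma slice_coord_separates:
  assumes "\<And>a. slice_coord j (p * a) = slice_coord j (q * a)"
  shows "p = q"
proof -
  have "qre ((p - q) * qcnj (p - q)) = 0"
    using arg_cong[OF assms[of "qcnj (p - q)"], of Re] by (simp add: slice_coord_def left_diff_distrib)
  then have "(norm (p - q))\<^sup>2 = 0" unfolding quat_mult_qcnj by simp
  then show ?thesis by simp
qed

section \<open>The closed form\<close>

text \<open>It serves twice: as the value of the kernel, and, read as a function of \<open>q\<close>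
  for fixed \<open>r\<close>, as the element representing evaluation at \<open>r\<close>.\<close>

definition bergman_formula :: "quat \<Rightarrow> quat \<Rightarrow> quat" where
  "bergman_formula q r = (1 / pi) *\<^sub>R
      ((1 - 2 * qcnj q * qcnj r + (qcnj q)\<^sup>2 * (qcnj r)\<^sup>2)
       * (1 - 2 * of_real (qre q) * qcnj r + of_real ((norm q)\<^sup>2) * (qcnj r)\<^sup>2) powi (-2))"

text \<open>The real polynomial with roots \<open>z\<close> and \<open>cnj z\<close> splits the
  denominator into two factors, neither of which vanishes as both products have modulus below 1.
  Only \<open>x\<close> and \<open>x\<^sup>2 + y\<^sup>2\<close> enter, so the last claim also
  covers points outside the slice of \<open>j\<close>.\<close>

lemma bergman_denominator_embed:
  assumes j: "j \<in> imag_units" and w: "norm w < 1" and xy: "x\<^sup>2 + y\<^sup>2 < 1"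
  shows "1 - 2 * of_real x * qcnj (slice_embed j w) + of_real (x\<^sup>2 + y\<^sup>2) * (qcnj (slice_embed j w))\<^sup>2
      = slice_embed j ((1 - Complex x y * cnj w) * (1 - cnj (Complex x y) * cnj w))" (is ?eq)
    and "(1 - Complex x y * cnj w) * (1 - cnj (Complex x y) * cnj w) \<noteq> 0" (is ?nz)
    and "1 - 2 * of_real x * qcnj (slice_embed j w) + of_real (x\<^sup>2 + y\<^sup>2) * (qcnj (slice_embed j w))\<^sup>2 \<noteq> 0"
proof -
  have "(1 - Complex x y * cnj w) * (1 - cnj (Complex x y) * cnj w)
      = 1 - of_real (2 * x) * cnj w + of_real (x\<^sup>2 + y\<^sup>2) * (cnj w)\<^sup>2"
    by (simp add: complex_eq_iff power2_eq_square algebra_simps)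
  then show ?eq
    by (simp add: qcnj_slice_embed[OF j] slice_embed_add slice_embed_diff slice_embed_mult[OF j]
        slice_embed_power[OF j] slice_embed_1 slice_embed_of_real del: of_real_add of_real_power)
      (simp add: slice_embed_of_real slice_embed_numeral flip: of_real_mult)
  have "norm (Complex x y) < 1" using xy by (simp add: cmod_def)
  then have "norm (Complex x y * cnj w) < 1" "norm (cnj (Complex x y) * cnj w) < 1"
    unfolding norm_mult complex_mod_cnj using w mult_left_le[of "norm w" "norm (Complex x y)"] by simp_all
  then show nz: ?nz by (metis (no_types) eq_iff_diff_eq_0 less_irrefl mult_eq_0_iff norm_one)
  show "1 - 2 * of_real x * qcnj (slice_embed j w) + of_real (x\<^sup>2 + y\<^sup>2) * (qcnj (slice_embed j w))\<^sup>2 \<noteq> 0"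
    unfolding \<open>?eq\<close> using nz norm_slice_embed[OF j] by (metis norm_eq_zero)
qed

lemma norm_slice_point_sq: "j \<in> imag_units \<Longrightarrow> (norm (slice_point j x y))\<^sup>2 = x\<^sup>2 + y\<^sup>2"
  by (simp add: slice_point_eq_embed norm_slice_embed cmod_power2)

text \<open>Within a slice everything commutes: the numerator is
  \<open>(1 - cnj z * cnj w)\<^sup>2\<close> and cancels one of the two squared factors of the
  denominator.\<close>

lemma bergman_formula_embed:
  assumes j: "j \<in> imag_units" and z: "norm z < 1" and w: "norm w < 1"
  shows "bergman_formula (slice_embed j z) (slice_embed j w) = slice_embed j (inverse (of_real pi * (1 - z * cnj w)\<^sup>2))"
proof -
  have xy: "(Re z)\<^sup>2 + (Im z)\<^sup>2 < 1" using z by (simp add: cmod_def)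
  have n: "(norm (slice_embed j z))\<^sup>2 = (Re z)\<^sup>2 + (Im z)\<^sup>2"
    by (simp add: norm_slice_embed[OF j] cmod_power2)
  have num: "1 - 2 * qcnj (slice_embed j z) * qcnj (slice_embed j w)
        + (qcnj (slice_embed j z))\<^sup>2 * (qcnj (slice_embed j w))\<^sup>2
      = slice_embed j ((1 - cnj z * cnj w)\<^sup>2)"
  proof -
    have "(1 - cnj z * cnj w)\<^sup>2 = 1 - 2 * cnj z * cnj w + (cnj z)\<^sup>2 * (cnj w)\<^sup>2"
      by (simp add: power2_eq_square algebra_simps)
    then show ?thesis
      by (simp add: qcnj_slice_embed[OF j] slice_embed_add slice_embed_diff slice_embed_mult[OF j]
        slice_embed_power[OF j] slice_embed_1 slice_embed_numeral)
  qed
  note den = bergman_denominator_embed[OF j w xy, unfolded complex.collapse]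
  have "bergman_formula (slice_embed j z) (slice_embed j w)
     = slice_embed j ((1 / pi) *\<^sub>R ((1 - cnj z * cnj w)\<^sup>2
        * (inverse ((1 - z * cnj w) * (1 - cnj z * cnj w)))\<^sup>2))"
    unfolding bergman_formula_def num n qre_slice_embed[OF j] den(1)
    by (simp add: power_int_def
        flip: slice_embed_scaleR slice_embed_mult[OF j] slice_embed_power[OF j] slice_embed_inverse[OF j])
  also have "(1 / pi) *\<^sub>R ((1 - cnj z * cnj w)\<^sup>2 * (inverse ((1 - z * cnj w) * (1 - cnj z * cnj w)))\<^sup>2)
     = inverse (of_real pi * (1 - z * cnj w)\<^sup>2)"
    using den(2) by (simp add: scaleR_conv_of_real power_mult_distrib divide_simps)
  finally show ?thesis .
qed

text \<open>The representation formula for the identity function: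
  \<open>(1 - i * j) * j = j + i\<close> and \<open>(1 + i * j) * (- j) = i - j\<close> add up to
  \<open>2 * i\<close>.\<close>

lemma slice_representation:
  fixes i j :: quat and a b :: real
  assumes "i \<in> imag_units" "j \<in> imag_units"
  shows "slice_point i a b = (1/2) *\<^sub>R ((1 - i * j) * slice_point j a b)
      + (1/2) *\<^sub>R ((1 + i * j) * slice_point j a (- b))"
proof -
  have "i * j * j = - i" by (simp add: mult.assoc imag_unitsD[OF assms(2)])
  then show ?thesis
    by (simp add: slice_point_eq_embed slice_embed_alt algebra_simps scaleR_2[symmetric])
qed

text \<open>The factor \<open>D\<close> is common to all three points and stands on the right, so
  the formula need only be checked for the numerator, that is for the powers \<open>1\<close>,
  \<open>q\<close>, \<open>q\<^sup>2\<close> of the conjugated variable.\<close>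

lemma bergman_formula_representation:
  assumes i: "i \<in> imag_units" and j: "j \<in> imag_units"
  shows "bergman_formula (slice_point i x y) r =
      (1/2) *\<^sub>R ((1 - i * j) * bergman_formula (slice_point j x y) r)
      + (1/2) *\<^sub>R ((1 + i * j) * bergman_formula (slice_point j x (- y)) r)"
proof -
  define D where "D = (1 - 2 * of_real x * qcnj r + of_real (x\<^sup>2 + y\<^sup>2) * (qcnj r)\<^sup>2) powi (-2)"
  define P where "P q = 1 - 2 * q * qcnj r + q\<^sup>2 * (qcnj r)\<^sup>2" for q
  have c: "qcnj (slice_point k a b) = slice_point k a (- b)" if "k \<in> imag_units" for k a b
    by (simp add: quat_eq_iff imag_unitsD[OF that])
  \<comment> \<open>The square has coordinates independent of the unit \<open>k\<close>, so
    \<open>slice_representation\<close> applies to it as well.\<close>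
  have s: "(slice_point k x b)\<^sup>2 = slice_point k (x\<^sup>2 - b\<^sup>2) (2 * x * b)" if "k \<in> imag_units" for k b
    by (simp add: slice_point_eq_embed slice_embed_power[OF that, symmetric])
      (simp add: complex_eq_iff power2_eq_square arg_cong[where f="slice_embed k"])
  have F: "bergman_formula (slice_point k x b) r = (1 / pi) *\<^sub>R (P (slice_point k x (- b)) * D)"
    if "k \<in> imag_units" "b\<^sup>2 = y\<^sup>2" for k b
    using that by (simp add: bergman_formula_def norm_slice_point_sq imag_unitsD c P_def D_def)
  have P: "P (slice_point i x (- y)) = (1/2) *\<^sub>R ((1 - i * j) * P (slice_point j x (- y)))
      + (1/2) *\<^sub>R ((1 + i * j) * P (slice_point j x y))"
  proof -
    have 1: "(1::quat) = (1/2) *\<^sub>R (1 - i * j) + (1/2) *\<^sub>R (1 + i * j)"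
      by (simp add: algebra_simps scaleR_2[symmetric])
    have 2: "(slice_point i x (- y))\<^sup>2 = (1/2) *\<^sub>R ((1 - i * j) * (slice_point j x (- y))\<^sup>2)
      + (1/2) *\<^sub>R ((1 + i * j) * (slice_point j x y)\<^sup>2)"
      using slice_representation[OF i j, of "x\<^sup>2 - y\<^sup>2" "2 * x * - y"] by (simp add: s i j)
    have 3: "slice_point i x (- y) = (1/2) *\<^sub>R ((1 - i * j) * slice_point j x (- y))
      + (1/2) *\<^sub>R ((1 + i * j) * slice_point j x y)"
      using slice_representation[OF i j, of x "- y"] by simp
    have "P (slice_point i x (- y)) = 1 - 2 *\<^sub>R (slice_point i x (- y) * qcnj r) + (slice_point i x (- y))\<^sup>2 * (qcnj r)\<^sup>2"
      by (simp add: P_def scaleR_2 mult_2 distrib_right)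
    also have "\<dots> = ((1/2) *\<^sub>R (1 - i * j) + (1/2) *\<^sub>R (1 + i * j))
        - 2 *\<^sub>R (((1/2) *\<^sub>R ((1 - i * j) * slice_point j x (- y))
           + (1/2) *\<^sub>R ((1 + i * j) * slice_point j x y)) * qcnj r)
        + ((1/2) *\<^sub>R ((1 - i * j) * (slice_point j x (- y))\<^sup>2)
           + (1/2) *\<^sub>R ((1 + i * j) * (slice_point j x y)\<^sup>2)) * (qcnj r)\<^sup>2"
      unfolding 2 3[symmetric] 1[symmetric] ..
    also have "\<dots> = (1/2) *\<^sub>R ((1 - i * j) * P (slice_point j x (- y)))
      + (1/2) *\<^sub>R ((1 + i * j) * P (slice_point j x y))"
    proof -
      have "P q = 1 - 2 *\<^sub>R (q * qcnj r) + q\<^sup>2 * (qcnj r)\<^sup>2" for q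
        by (simp add: P_def scaleR_2 mult_2 distrib_right)
      then show ?thesis by (simp add: distrib_left right_diff_distrib left_diff_distrib distrib_right
            scaleR_add_right scaleR_diff_right mult.assoc)
    qed
    finally show ?thesis .
  qed
  show ?thesis
    using arg_cong[OF P, of "\<lambda>t. (1 / pi) *\<^sub>R (t * D)"]
    by (simp add: F i j distrib_right mult.assoc scaleR_add_right mult.commute[of pi])
qed

section \<open>Slice regularity of the closed form\<close>

lemma differentiable_on_bergman_formula:
  assumes j: "j \<in> imag_units" and v: "norm v < 1"
  shows "(\<lambda>q. bergman_formula q (slice_embed j v)) differentiable_on ball 0 1"
  unfolding differentiable_on_def
proof
  fix q :: quat
  assume q: "q \<in> ball 0 1"
  define r where "r = qcnj (slice_embed j v)"
  define D where "D p = 1 - 2 * of_real (qre p) * r + of_real ((norm p)\<^sup>2) * r\<^sup>2" for p :: quat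
  define N where "N p = 1 - 2 * qcnj p * r + (qcnj p)\<^sup>2 * r\<^sup>2" for p
  have D0: "D q \<noteq> 0"
  proof -
    \<comment> \<open>The point \<open>q\<close> need not share a slice with \<open>v\<close>; its
      own unit \<open>i\<close> supplies the coordinates \<open>x\<close> and
      \<open>y\<close>.\<close>
    obtain i x y where i: "i \<in> imag_units" and qi: "q = slice_point i x y" by (rule quat_slice_cases)
    have n: "(norm q)\<^sup>2 = x\<^sup>2 + y\<^sup>2" "qre q = x" using i by (simp_all add: qi norm_slice_point_sq imag_unitsD)
    have "(norm q)\<^sup>2 < 1" using q by (simp add: abs_square_less_1)
    then show ?thesis
      using bergman_denominator_embed(3)[OF j v, of x y] unfolding D_def r_def n by simp
  qed
  have lin: "bounded_linear (\<lambda>p. of_real (qre p) :: quat)"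
    by (rule bounded_linear_compose[OF bounded_linear_of_real bounded_linear_qre])
  have dc: "qcnj differentiable (at q within ball 0 1)"
    "(\<lambda>p. of_real (qre p) :: quat) differentiable (at q within ball 0 1)"
    by (auto intro: bounded_linear_imp_differentiable bounded_linear_qcnj lin)
  \<comment> \<open>Writing the squared norm as \<open>p * qcnj p\<close> avoids the norm itself,
    which is not differentiable at \<open>0\<close>.\<close>
  have dn: "(\<lambda>p. of_real ((norm p)\<^sup>2) :: quat) differentiable (at q within ball 0 1)"
  proof -
    have "(\<lambda>p. p * qcnj p) differentiable (at q within ball 0 1)"
      by (intro differentiable_mult dc differentiable_ident)
    then show ?thesis by (simp add: quat_mult_qcnj of_real_def)
  qed
  have dD: "D differentiable (at q within ball 0 1)" and dN: "N differentiable (at q within ball 0 1)"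
    unfolding D_def N_def power2_eq_square[of "qcnj _"]
    by (intro differentiable_add differentiable_diff differentiable_mult differentiable_const dc dn)+
  have dI: "(\<lambda>p. inverse (D p)) differentiable (at q within ball 0 1)"
  proof -
    obtain D' where "(D has_derivative D') (at q within ball 0 1)"
      using dD unfolding differentiable_def by blast
    from Deriv.has_derivative_inverse[OF D0 this] show ?thesis
      unfolding differentiable_def by blast
  qed
  have "(\<lambda>p. (1 / pi) *\<^sub>R (N p * (inverse (D p) * inverse (D p)))) differentiable (at q within ball 0 1)"
    by (intro differentiable_scaleR differentiable_mult differentiable_const dN dI)
  also have "(\<lambda>p. (1 / pi) *\<^sub>R (N p * (inverse (D p) * inverse (D p)))) = (\<lambda>p. bergman_formula p (slice_embed j v))"
    by (simp add: bergman_formula_def N_def D_def r_def power_int_def power2_eq_square)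
  finally show "(\<lambda>p. bergman_formula p (slice_embed j v)) differentiable (at q within ball 0 1)" .
qed

lemma slice_point_has_vector_derivative:
  "((\<lambda>s. slice_point i s y) has_vector_derivative 1) (at x)"
  "((\<lambda>t. slice_point i x t) has_vector_derivative i) (at y)"
  unfolding slice_point_def
  by (auto intro!: derivative_eq_intros simp: of_real_def)

lemma continuous_on_slice_point:
  "continuous_on UNIV (\<lambda>s. slice_point i s y)" "continuous_on UNIV (\<lambda>t. slice_point i x t)"
  unfolding slice_point_def by (intro continuous_intros)+

text \<open>On the slice of \<open>j\<close> the function is the holomorphic \<open>h\<close>, and
  the representation formula expresses it on every other slice through \<open>h\<close> at two
  conjugate points. The Cauchy-Riemann equation there follows from the one for
  \<open>h\<close>.\<close>

lemma bergman_formula_slice_regular: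
  assumes j: "j \<in> imag_units" and v: "norm v < 1"
  shows "restrict (\<lambda>q. bergman_formula q (slice_embed j v)) (ball 0 1) \<in> slice_regular (ball 0 1)"
    (is "?k \<in> _")
proof -
  define h where "h z = inverse (of_real pi * (1 - z * cnj v)\<^sup>2)" for z
  have h: "h holomorphic_on ball 0 1"
    unfolding h_def
  proof (intro holomorphic_intros)
    fix z assume "z \<in> ball (0::complex) 1"
    then have "norm (z * cnj v) < 1"
      using v mult_left_le[of "norm v" "norm z"] by (simp add: norm_mult)
    then have "z * cnj v \<noteq> 1" by auto
    then show "of_real pi * (1 - z * cnj v)\<^sup>2 \<noteq> 0" by simp
  qed
  have k: "?k (slice_point i a b) = (1/2) *\<^sub>R ((1 - i * j) * slice_embed j (h (Complex a b)))
      + (1/2) *\<^sub>R ((1 + i * j) * slice_embed j (h (Complex a (- b))))"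
    if i: "i \<in> imag_units" and "slice_point i a b \<in> ball 0 1" for i a b
  proof -
    have "norm (Complex a b) < 1" using that by (simp add: slice_point_eq_embed norm_slice_embed)
    moreover from this have "norm (Complex a (- b)) < 1" by (simp add: cmod_def)
    moreover have "?k (slice_point i a b) = bergman_formula (slice_point i a b) (slice_embed j v)"
      using that by simp
    ultimately show ?thesis
      by (simp only: bergman_formula_representation[OF i j])
        (simp only: slice_point_eq_embed bergman_formula_embed[OF j _ v] h_def)
  qed
  have "vector_derivative (\<lambda>s. ?k (slice_point i s y)) (at x)
        + i * vector_derivative (\<lambda>t. ?k (slice_point i x t)) (at y) = 0"
    if i: "i \<in> imag_units" and B: "slice_point i x y \<in> ball 0 1" for i x y
  proof -
    let ?p = "deriv h (Complex x y)" and ?m = "deriv h (Complex x (- y))"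
    let ?A = "(1/2) *\<^sub>R (1 - i * j)" and ?B = "(1/2) *\<^sub>R (1 + i * j)"
    have "norm (Complex x y) < 1" using that by (simp add: slice_point_eq_embed norm_slice_embed)
    moreover from this have "norm (Complex x (- y)) < 1" by (simp add: cmod_def)
    ultimately have hd: "(h has_field_derivative ?p) (at (Complex x y))"
        "(h has_field_derivative ?m) (at (Complex x (- y)))"
      by (auto intro!: holomorphic_derivI[OF h])
    have path: "((\<lambda>s. Complex s b) has_vector_derivative 1) (at a)"
       "((\<lambda>t. Complex a t) has_vector_derivative \<i>) (at b)"
       "((\<lambda>t. Complex a (- t)) has_vector_derivative - \<i>) (at b)" for a b
      unfolding Complex_eq by (auto intro!: derivative_eq_intros simp: of_real_def)
    note E = bounded_linear.has_vector_derivative[OF bounded_linear_slice_embed]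
    have d1: "((\<lambda>s. ?A * slice_embed j (h (Complex s y)) + ?B * slice_embed j (h (Complex s (- y))))
        has_vector_derivative ?A * slice_embed j ?p + ?B * slice_embed j ?m) (at x)"
      using E[OF field_vector_diff_chain_at[OF path(1) hd(1)]] E[OF field_vector_diff_chain_at[OF path(1) hd(2)]]
      by (auto intro!: derivative_eq_intros simp: o_def)
    have d2: "((\<lambda>t. ?A * slice_embed j (h (Complex x t)) + ?B * slice_embed j (h (Complex x (- t))))
        has_vector_derivative ?A * slice_embed j (\<i> * ?p) + ?B * slice_embed j (- \<i> * ?m)) (at y)"
      using E[OF field_vector_diff_chain_at[OF path(2) hd(1)]] E[OF field_vector_diff_chain_at[OF path(3) hd(2)]]
      by (auto intro!: derivative_eq_intros simp: o_def)
    \<comment> \<open>The expression through \<open>h\<close> is available only in the ball, so the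
      derivative is carried over on the open set of parameters that stay inside.\<close>
    have d1': "((\<lambda>s. ?k (slice_point i s y)) has_vector_derivative ?A * slice_embed j ?p + ?B * slice_embed j ?m) (at x)"
    proof (rule has_vector_derivative_transform_within_open[OF d1])
      show "open ((\<lambda>s. slice_point i s y) -` ball 0 1)"
        by (rule open_vimage[OF open_ball continuous_on_slice_point(1)])
      show "x \<in> (\<lambda>s. slice_point i s y) -` ball 0 1" using B by simp
    qed (use k[OF i] in auto)
    have d2': "((\<lambda>t. ?k (slice_point i x t)) has_vector_derivative
        ?A * slice_embed j (\<i> * ?p) + ?B * slice_embed j (- \<i> * ?m)) (at y)"
    proof (rule has_vector_derivative_transform_within_open[OF d2])
      show "open ((\<lambda>t. slice_point i x t) -` ball 0 1)"
        by (rule open_vimage[OF open_ball continuous_on_slice_point(2)])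
      show "y \<in> (\<lambda>t. slice_point i x t) -` ball 0 1" using B by simp
    qed (use k[OF i] in auto)
    have ej: "slice_embed j \<i> = j" "slice_embed j (- \<i>) = - j" by (simp_all add: slice_embed_alt)
    have ii: "i * (i * p) = - p" "j * (j * p) = - p" for p
      by (simp_all add: mult.assoc[symmetric] imag_unitsD i j)
    \<comment> \<open>The cancellation rests on \<open>i * ?A * j = - ?A\<close> and
      \<open>i * ?B * (- j) = - ?B\<close>.\<close>
    show ?thesis
      unfolding vector_derivative_at[OF d1'] vector_derivative_at[OF d2'] slice_embed_mult[OF j] ej
      by (simp add: algebra_simps ii)
  qed
  moreover have "?k differentiable_on ball 0 1"
    unfolding differentiable_on_def
  proof
    fix q :: quat assume q: "q \<in> ball 0 1"
    then obtain D where "((\<lambda>q. bergman_formula q (slice_embed j v)) has_derivative D) (at q within ball 0 1)"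
      using differentiable_on_bergman_formula[OF j v] unfolding differentiable_on_def differentiable_def by blast
    from has_derivative_transform[OF q _ this, of ?k]
    show "?k differentiable (at q within ball 0 1)" unfolding differentiable_def by auto
  qed
  ultimately show ?thesis by (simp add: slice_regular_def)
qed

section \<open>Slice regular functions\<close>

lemma slice_regular_continuous_on: "f \<in> slice_regular \<Omega> \<Longrightarrow> continuous_on \<Omega> f"
  by (simp add: slice_regular_def differentiable_imp_continuous_on)

text \<open>The slice equation says \<open>f' i = i * f' 1\<close>, so along the slice the
  derivative is left multiplication of \<open>f' 1\<close> by the increment. A coordinate that is
  complex linear from the left turns this into a complex derivative.\<close>

lemma slice_regular_coord_holomorphic:
  assumes f: "f \<in> slice_regular (ball 0 1)" and i: "i \<in> imag_units"
  shows "(\<lambda>z. slice_coord i (f (slice_embed i z) * a)) holomorphic_on ball 0 1"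
proof (rule holomorphic_onI)
  fix z :: complex
  assume z: "z \<in> ball 0 1"
  define x y where "x = Re z" and "y = Im z"
  have p: "slice_embed i z = slice_point i x y" by (simp add: slice_embed_def x_def y_def)
  have B: "slice_point i x y \<in> ball 0 1" using z by (simp add: p[symmetric] norm_slice_embed[OF i])
  then have "f differentiable (at (slice_point i x y) within ball 0 1)"
    using f unfolding slice_regular_def differentiable_on_def by blast
  then obtain f' where f': "(f has_derivative f') (at (slice_point i x y))"
    unfolding at_within_open[OF B open_ball] differentiable_def by blast
  then interpret f': bounded_linear f' by (rule has_derivative_bounded_linear)
  have "((\<lambda>s. f (slice_point i s y)) has_vector_derivative f' 1) (at x)"
       "((\<lambda>t. f (slice_point i x t)) has_vector_derivative f' i) (at y)"
    using vector_derivative_diff_chain_within[of "\<lambda>s. slice_point i s y" 1 x UNIV f f']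
      vector_derivative_diff_chain_within[of "\<lambda>t. slice_point i x t" i y UNIV f f']
      slice_point_has_vector_derivative f' by (auto simp: o_def intro: has_derivative_at_withinI)
  moreover have "vector_derivative (\<lambda>s. f (slice_point i s y)) (at x)
        + i * vector_derivative (\<lambda>t. f (slice_point i x t)) (at y) = 0"
    using f i B unfolding slice_regular_def by blast
  ultimately have CR: "f' 1 + i * f' i = 0" by (simp add: vector_derivative_at)
  have "i * (f' 1 + i * f' i) = i * f' 1 - f' i"
    by (simp add: distrib_left mult.assoc[symmetric] imag_unitsD[OF i])
  with CR have fi: "f' i = i * f' 1" by simp
  have fe: "f' (slice_embed i h) = slice_embed i h * f' 1" for h
    by (simp add: slice_embed_alt f'.add f'.scaleR fi distrib_right)
  have "((\<lambda>w. f (slice_embed i w)) has_derivative (\<lambda>h. f' (slice_embed i h))) (at z)"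
    using has_derivative_compose[OF bounded_linear_imp_has_derivative[OF bounded_linear_slice_embed], of f f' i z UNIV]
      f' by (simp add: p)
  from bounded_linear.has_derivative[OF bounded_linear_slice_coord[of i a] this]
  have "((\<lambda>w. slice_coord i (f (slice_embed i w) * a)) has_derivative
      (\<lambda>h. slice_coord i (f' 1 * a) * h)) (at z)"
    by (simp add: fe slice_coord_mult[OF i] mult.assoc mult.commute)
  then have "((\<lambda>w. slice_coord i (f (slice_embed i w) * a)) has_field_derivative slice_coord i (f' 1 * a)) (at z)"
    by (simp add: has_field_derivative_def)
  then show "(\<lambda>w. slice_coord i (f (slice_embed i w) * a)) field_differentiable at z within ball 0 1"
    using field_differentiable_def field_differentiable_at_within by blast
qed

text \<open>The real diameter lies in every slice. Agreement on one slice thus gives agreement on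
  the diameter, and the identity theorem for the coordinates spreads it over each other
  slice.\<close>

lemma slice_regular_eqI:
  assumes f: "f \<in> slice_regular (ball 0 1)" and g: "g \<in> slice_regular (ball 0 1)" and j: "j \<in> imag_units"
    and eq: "\<And>q. q \<in> slice (ball 0 1) j \<Longrightarrow> f q = g q"
  shows "f = g"
proof
  fix q
  show "f q = g q"
  proof (cases "q \<in> ball 0 1")
    case True
    obtain i x y where i: "i \<in> imag_units" and "q = slice_point i x y" by (rule quat_slice_cases)
    then have q: "q = slice_embed i (Complex x y)" by (simp add: slice_point_eq_embed)
    with True have z: "Complex x y \<in> ball 0 1" by (simp add: norm_slice_embed[OF i])
    show ?thesis
    proof (rule slice_coord_separates[of i])
      fix a
      define F where "F z = slice_coord i (f (slice_embed i z) * a) - slice_coord i (g (slice_embed i z) * a)" for z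
      have "F (Complex x y) = 0"
      proof (rule analytic_continuation[of F "ball 0 1" "of_real ` {-1<..<1}" 0])
        show "F holomorphic_on ball 0 1"
          unfolding F_def by (intro holomorphic_intros slice_regular_coord_holomorphic f g i)
        show "0 islimpt (of_real ` {-1<..<1} :: complex set)"
          unfolding islimpt_approachable
        proof (intro allI impI)
          fix e :: real assume "e > 0"
          then show "\<exists>x'\<in>of_real ` {-1<..<1}. x' \<noteq> (0::complex) \<and> dist x' 0 < e"
            by (intro bexI[of _ "of_real (min (e/2) (1/2))"]) auto
        qed
        fix w :: complex
        assume "w \<in> of_real ` {-1<..<1}"
        then obtain s where s: "w = of_real s" "-1 < s" "s < 1" by auto
        have "slice_embed i w = slice_embed j w" by (simp add: s slice_embed_of_real)
        moreover have "slice_embed j w \<in> slice (ball 0 1) j"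
          using s by (simp add: slice_eq norm_slice_embed[OF j])
        ultimately show "F w = 0" using eq by (simp add: F_def)
      qed (use z in auto)
      then show "slice_coord i (f q * a) = slice_coord i (g q * a)" by (simp add: F_def q)
    qed
  next
    \<comment> \<open>Outside the ball both functions are \<open>undefined\<close> by
      extensionality.\<close>
    case False
    then show ?thesis using f g unfolding slice_regular_def by (auto simp: extensional_def)
  qed
qed

text \<open>The slice plane is the fixed-point set of the continuous projection
  \<open>slice_embed j \<circ> slice_coord j\<close>, hence closed; the factor \<open>1\<close> only
  matches the form of \<open>bounded_linear_slice_coord\<close>.\<close>

lemma slice_borel: "slice (ball 0 1) j \<in> sets borel" if j: "j \<in> imag_units"
proof -
  have "range (slice_embed j) = {p. slice_embed j (slice_coord j (p * 1)) = p}"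
  proof -
    have "slice_embed j (slice_coord j (slice_embed j z * 1)) = slice_embed j z" for z
    proof -
      have "slice_coord j 1 = 1" by (simp add: slice_coord_def complex_eq_iff imag_unitsD[OF j])
      then show ?thesis using slice_coord_mult[OF j, of z 1] by simp
    qed
    then show ?thesis by (auto, metis rangeI)
  qed
  moreover have "closed {p. slice_embed j (slice_coord j (p * 1)) = p}"
    by (intro closed_Collect_eq continuous_on_id
      continuous_on_compose2[OF linear_continuous_on[OF bounded_linear_slice_embed]]
      linear_continuous_on bounded_linear_slice_coord) auto
  ultimately show ?thesis unfolding slice_eq by auto
qed

section \<open>The slice Bergman space\<close>

definition disc_embed :: "quat \<Rightarrow> real \<times> real \<Rightarrow> quat" where
  "disc_embed j p = slice_embed j (pair_complex p)"

lemma slice_measure_eq: "slice_measure j = distr lborel borel (disc_embed j)"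
  unfolding slice_measure_def disc_embed_def slice_embed_def pair_complex_sel case_prod_beta' ..

lemma continuous_on_disc_embed [continuous_intros]: "continuous_on S (disc_embed j)"
  unfolding disc_embed_def slice_embed_alt pair_complex_sel by (intro continuous_intros)

lemma borel_measurable_disc_embed [measurable]: "disc_embed j \<in> borel_measurable borel"
  by (intro borel_measurable_continuous_onI continuous_intros)

lemma disc_embed_in_slice: "j \<in> imag_units \<Longrightarrow> disc_embed j p \<in> slice (ball 0 1) j \<longleftrightarrow> p \<in> unit_disc"
  by (simp add: slice_eq disc_embed_def norm_slice_embed)

lemma disc_embed_in_ball: "j \<in> imag_units \<Longrightarrow> disc_embed j p \<in> ball 0 1 \<longleftrightarrow> p \<in> unit_disc"
  by (simp add: disc_embed_def norm_slice_embed)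

text \<open>Continuity is known on the open ball only, so \<open>f\<close> is first cut off there
  and then restricted to the Borel slice.\<close>

lemma borel_measurable_indicator_slice:
  fixes f :: "quat \<Rightarrow> 'a :: euclidean_space"
  assumes j: "j \<in> imag_units" and f: "continuous_on (ball 0 1) f"
  shows "(\<lambda>q. indicator (slice (ball 0 1) j) q *\<^sub>R f q) \<in> borel_measurable borel"
proof -
  have 1: "(\<lambda>q. indicator (ball 0 1) q *\<^sub>R f q) \<in> borel_measurable borel"
    using borel_measurable_continuous_on_indicator[OF _ f] by simp
  have [measurable]: "slice (ball 0 1) j \<in> sets borel" by (rule slice_borel[OF j])
  have "(\<lambda>q. indicator (slice (ball 0 1) j) q *\<^sub>R (indicator (ball 0 1) q *\<^sub>R f q)) \<in> borel_measurable borel"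
    using 1 by measurable
  also have "(\<lambda>q. indicator (slice (ball 0 1) j) q *\<^sub>R (indicator (ball 0 1) q *\<^sub>R f q))
     = (\<lambda>q. indicator (slice (ball 0 1) j) q *\<^sub>R f q)"
    by (rule ext) (simp add: slice_def indicator_def)
  finally show ?thesis .
qed

lemma slice_nn_integral_norm_sq:
  assumes j: "j \<in> imag_units" and f: "continuous_on (ball 0 1) f"
  shows "(\<integral>\<^sup>+q\<in>slice (ball 0 1) j. ennreal ((norm (f q))\<^sup>2) \<partial>slice_measure j)
    = (\<integral>\<^sup>+p. ennreal (indicator unit_disc p *\<^sub>R (norm (f (disc_embed j p)))\<^sup>2) \<partial>lborel)"
proof -
  have cont: "continuous_on (ball 0 1) (\<lambda>q. (norm (f q))\<^sup>2)" by (intro continuous_intros f)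
  note m = borel_measurable_indicator_slice[OF j cont]
  have "(\<integral>\<^sup>+q\<in>slice (ball 0 1) j. ennreal ((norm (f q))\<^sup>2) \<partial>slice_measure j)
     = (\<integral>\<^sup>+q. ennreal (indicator (slice (ball 0 1) j) q *\<^sub>R (norm (f q))\<^sup>2) \<partial>distr lborel borel (disc_embed j))"
    unfolding slice_measure_eq by (intro nn_integral_cong) (auto simp: indicator_def)
  also have "\<dots> = (\<integral>\<^sup>+p. ennreal (indicator (slice (ball 0 1) j) (disc_embed j p) *\<^sub>R (norm (f (disc_embed j p)))\<^sup>2) \<partial>lborel)"
    using m by (subst nn_integral_distr) simp_all
  finally show ?thesis
    by (simp only: indicator_def disc_embed_in_slice[OF j])
qed

lemma slice_inner_eq:
  assumes j: "j \<in> imag_units" and f: "continuous_on (ball 0 1) f" and g: "continuous_on (ball 0 1) g"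
  shows "slice_inner (ball 0 1) j f g = (LINT p:unit_disc|lborel. qcnj (f (disc_embed j p)) * g (disc_embed j p))"
proof -
  have "continuous_on (ball 0 1) (\<lambda>q. qcnj (f q) * g q)"
    by (intro continuous_intros g continuous_on_compose2[OF linear_continuous_on[OF bounded_linear_qcnj] f]) auto
  note m = borel_measurable_indicator_slice[OF j this]
  have ind: "indicator (slice (ball 0 1) j) (disc_embed j p) = (indicator unit_disc p :: real)" for p
    unfolding indicator_def disc_embed_in_slice[OF j] ..
  show ?thesis
    unfolding slice_inner_def set_lebesgue_integral_def slice_measure_eq
    using m by (subst integral_distr) (simp_all add: ind)
qed

lemma bergman_space_continuous_on: "f \<in> slice_bergman_space \<Omega> j \<Longrightarrow> continuous_on \<Omega> f"
  by (simp add: slice_bergman_space_def slice_regular_continuous_on)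

lemma continuous_on_disc_comp:
  assumes "j \<in> imag_units" "continuous_on (ball 0 1) f"
  shows "continuous_on unit_disc (\<lambda>p. f (disc_embed j p))"
  by (rule continuous_on_compose2[OF assms(2)])
    (use disc_embed_in_ball[OF assms(1)] in \<open>auto intro!: continuous_intros\<close>)

lemma bergman_space_integrable_sq:
  assumes j: "j \<in> imag_units" and f: "f \<in> slice_bergman_space (ball 0 1) j"
  shows "set_integrable lborel unit_disc (\<lambda>p. (norm (f (disc_embed j p)))\<^sup>2)"
  unfolding set_integrable_def
proof (rule integrableI_nonneg)
  note c = bergman_space_continuous_on[OF f]
  have "continuous_on unit_disc (\<lambda>p. (norm (f (disc_embed j p)))\<^sup>2)"
    by (intro continuous_intros continuous_on_disc_comp j c)
  from borel_measurable_continuous_on_indicator[OF _ this]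
  show "(\<lambda>p. indicator unit_disc p *\<^sub>R (norm (f (disc_embed j p)))\<^sup>2) \<in> borel_measurable lborel"
    by simp
  show "(\<integral>\<^sup>+p. ennreal (indicator unit_disc p *\<^sub>R (norm (f (disc_embed j p)))\<^sup>2) \<partial>lborel) < \<infinity>"
    using f unfolding slice_nn_integral_norm_sq[OF j c, symmetric] slice_bergman_space_def by blast
qed auto

text \<open>The elementary bound \<open>a * b \<le> a\<^sup>2 + b\<^sup>2\<close> replaces the
  Cauchy-Schwarz inequality.\<close>

lemma bergman_space_integrable_product:
  assumes j: "j \<in> imag_units" and f: "f \<in> slice_bergman_space (ball 0 1) j"
    and g: "g \<in> slice_bergman_space (ball 0 1) j"
  shows "set_integrable lborel unit_disc (\<lambda>p. qcnj (f (disc_embed j p)) * g (disc_embed j p))"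
  unfolding set_integrable_def
proof (rule Bochner_Integration.integrable_bound)
  let ?f = "\<lambda>p. f (disc_embed j p)" and ?g = "\<lambda>p. g (disc_embed j p)"
  show "integrable lborel (\<lambda>p. indicator unit_disc p *\<^sub>R (norm (?f p))\<^sup>2 + indicator unit_disc p *\<^sub>R (norm (?g p))\<^sup>2)"
    using bergman_space_integrable_sq[OF j f] bergman_space_integrable_sq[OF j g]
    unfolding set_integrable_def by (rule Bochner_Integration.integrable_add)
  have "continuous_on unit_disc (\<lambda>p. qcnj (?f p) * ?g p)"
    by (intro continuous_intros continuous_on_disc_comp j bergman_space_continuous_on[OF f]
        bergman_space_continuous_on[OF g]
        continuous_on_compose2[OF linear_continuous_on[OF bounded_linear_qcnj]]) auto
  from borel_measurable_continuous_on_indicator[OF _ this]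
  show "(\<lambda>p. indicator unit_disc p *\<^sub>R (qcnj (?f p) * ?g p)) \<in> borel_measurable lborel"
    by simp
  have "norm (?f p) * norm (?g p) \<le> (norm (?f p))\<^sup>2 + (norm (?g p))\<^sup>2" for p
    using sum_squares_bound[of "norm (?f p)" "norm (?g p)"] mult_nonneg_nonneg[OF norm_ge_zero[of "?f p"] norm_ge_zero[of "?g p"]]
    by linarith
  then show "AE p in lborel. norm (indicator unit_disc p *\<^sub>R (qcnj (?f p) * ?g p))
      \<le> norm (indicator unit_disc p *\<^sub>R (norm (?f p))\<^sup>2 + indicator unit_disc p *\<^sub>R (norm (?g p))\<^sup>2)"
    by (auto simp: indicator_def norm_mult)
qed

text \<open>The disc has finite area and \<open>a \<le> 1 + a\<^sup>2\<close>; this supplies the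
  integrability hypothesis of \<open>bergman_reproducing\<close>.\<close>

lemma bergman_space_integrable:
  assumes j: "j \<in> imag_units" and f: "f \<in> slice_bergman_space (ball 0 1) j"
  shows "set_integrable lborel unit_disc (\<lambda>p. f (disc_embed j p))"
  unfolding set_integrable_def
proof (rule Bochner_Integration.integrable_bound)
  let ?f = "\<lambda>p. f (disc_embed j p)"
  have "integrable lborel (indicator unit_disc :: _ \<Rightarrow> real)"
    using emeasure_lborel_ball_finite[of 0 1] by (intro integrable_real_indicator) simp_all
  then show "integrable lborel (\<lambda>p. indicator unit_disc p + indicator unit_disc p *\<^sub>R (norm (?f p))\<^sup>2)"
    using bergman_space_integrable_sq[OF j f]
    unfolding set_integrable_def by (rule Bochner_Integration.integrable_add)
  show "(\<lambda>p. indicator unit_disc p *\<^sub>R ?f p) \<in> borel_measurable lborel"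
    using borel_measurable_continuous_on_indicator[OF _ continuous_on_disc_comp[OF j bergman_space_continuous_on[OF f]]]
    by simp
  have "norm (?f p) \<le> 1 + (norm (?f p))\<^sup>2" for p
  proof -
    have "2 * norm (?f p) \<le> 1 + (norm (?f p))\<^sup>2"
      using sum_squares_bound[of 1 "norm (?f p)"] by simp
    then show ?thesis using norm_ge_zero[of "?f p"] by linarith
  qed
  then show "AE p in lborel. norm (indicator unit_disc p *\<^sub>R ?f p)
      \<le> norm (indicator unit_disc p + indicator unit_disc p *\<^sub>R (norm (?f p))\<^sup>2)"
    by (auto simp: indicator_def)
qed

section \<open>The element representing evaluation at a point\<close>

definition bergman_element :: "quat \<Rightarrow> quat \<Rightarrow> quat" where
  "bergman_element q = restrict (\<lambda>p. bergman_formula p q) (ball 0 1)"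

lemma bergman_element_disc_embed:
  assumes "j \<in> imag_units" "p \<in> unit_disc" "norm v < 1"
  shows "bergman_element (slice_embed j v) (disc_embed j p)
    = slice_embed j (inverse (of_real pi * (1 - pair_complex p * cnj v)\<^sup>2))"
proof -
  have "disc_embed j p \<in> ball 0 1" using disc_embed_in_ball assms by blast
  then show ?thesis
    unfolding bergman_element_def restrict_apply disc_embed_def using assms
    by (simp add: bergman_formula_embed)
qed

text \<open>Since \<open>norm v < 1\<close>, the kernel stays bounded up to the boundary of the
  disc, and a bounded function is square integrable on a set of finite area.\<close>

lemma bergman_element_in_space:
  assumes j: "j \<in> imag_units" and v: "norm v < 1"
  shows "bergman_element (slice_embed j v) \<in> slice_bergman_space (ball 0 1) j"
proof -
  have reg: "bergman_element (slice_embed j v) \<in> slice_regular (ball 0 1)"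
    unfolding bergman_element_def by (rule bergman_formula_slice_regular[OF j v])
  \<comment> \<open>The square of the bound obtained from
    \<open>1 - norm v \<le> norm (1 - p * cnj v)\<close>.\<close>
  define M where "M = (inverse (pi * (1 - norm v)\<^sup>2))\<^sup>2"
  have bound: "indicator unit_disc p *\<^sub>R (norm (bergman_element (slice_embed j v) (disc_embed j p)))\<^sup>2
      \<le> M * indicator unit_disc p" for p
  proof (cases "p \<in> unit_disc")
    case True
    have "norm (pair_complex p * cnj v) \<le> norm v"
      using True by (simp add: norm_mult mult_left_le_one_le)
    then have "1 - norm v \<le> norm (1 - pair_complex p * cnj v)"
      using norm_triangle_ineq2[of 1 "pair_complex p * cnj v"] by simp
    then have "pi * (1 - norm v)\<^sup>2 \<le> pi * (norm (1 - pair_complex p * cnj v))\<^sup>2"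
      using v by (intro mult_left_mono power_mono) auto
    then have "inverse (pi * (norm (1 - pair_complex p * cnj v))\<^sup>2) \<le> inverse (pi * (1 - norm v)\<^sup>2)"
      using v by (intro le_imp_inverse_le) auto
    moreover have "norm (bergman_element (slice_embed j v) (disc_embed j p))
       = inverse (pi * (norm (1 - pair_complex p * cnj v))\<^sup>2)"
      unfolding bergman_element_disc_embed[OF j True v] norm_slice_embed[OF j]
      by (simp add: norm_inverse norm_mult norm_power)
    ultimately show ?thesis using True unfolding M_def by (auto intro!: power_mono)
  qed simp
  have "(\<integral>\<^sup>+p. ennreal (indicator unit_disc p *\<^sub>R (norm (bergman_element (slice_embed j v) (disc_embed j p)))\<^sup>2) \<partial>lborel)
     \<le> (\<integral>\<^sup>+p. ennreal M * indicator unit_disc p \<partial>lborel)"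
  proof (rule nn_integral_mono)
    fix p
    have "ennreal (M * indicator unit_disc p) = ennreal M * indicator unit_disc p"
      by (simp add: indicator_def)
    with ennreal_leI[OF bound[of p]]
    show "ennreal (indicator unit_disc p *\<^sub>R (norm (bergman_element (slice_embed j v) (disc_embed j p)))\<^sup>2)
      \<le> ennreal M * indicator unit_disc p" by (simp only:)
  qed
  also have "\<dots> = ennreal M * emeasure lborel unit_disc"
    by (rule nn_integral_cmult_indicator) simp
  also have "\<dots> < \<infinity>"
    using emeasure_lborel_ball_finite[of "0 :: real \<times> real" 1] by (simp add: ennreal_mult_less_top)
  finally show ?thesis
    using reg unfolding slice_bergman_space_def
    by (simp add: slice_nn_integral_norm_sq[OF j slice_regular_continuous_on[OF reg]])
qed

text \<open>Each coordinate functional commutes with the integral. The conjugated kernel has values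
  in the slice plane and stands on the left, so it comes out as a complex factor, leaving the
  classical identity for the coordinate of \<open>f\<close>.\<close>

lemma bergman_element_reproducing:
  assumes j: "j \<in> imag_units" and v: "norm v < 1" and f: "f \<in> slice_bergman_space (ball 0 1) j"
  shows "f (slice_embed j v) = slice_inner (ball 0 1) j (bergman_element (slice_embed j v)) f"
proof (rule slice_coord_separates[of j])
  fix a
  let ?k = "bergman_element (slice_embed j v)"
  note kin = bergman_element_in_space[OF j v]
  have freg: "f \<in> slice_regular (ball 0 1)" using f by (simp add: slice_bergman_space_def)
  note bl = bounded_linear_slice_coord[of j a]
  define g where "g z = slice_coord j (f (slice_embed j z) * a)" for z
  have hol: "g holomorphic_on ball 0 1"
    unfolding g_def by (rule slice_regular_coord_holomorphic[OF freg j])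
  have intg: "set_integrable lborel unit_disc (\<lambda>p. g (pair_complex p))"
    using integrable_bounded_linear[OF bl bergman_space_integrable[OF j f, unfolded set_integrable_def]]
    unfolding linear_scale[OF bounded_linear.linear[OF bl]] by (simp add: set_integrable_def g_def disc_embed_def)
  have "slice_coord j (slice_inner (ball 0 1) j ?k f * a)
     = (LINT p:unit_disc|lborel. slice_coord j (qcnj (?k (disc_embed j p)) * f (disc_embed j p) * a))"
    unfolding slice_inner_eq[OF j bergman_space_continuous_on[OF kin] bergman_space_continuous_on[OF f]]
      set_lebesgue_integral_def
    using integral_bounded_linear[OF bl bergman_space_integrable_product[OF j kin f, unfolded set_integrable_def]]
    by (simp only: linear_scale[OF bounded_linear.linear[OF bl]])
  also have "\<dots> = (LINT p:unit_disc|lborel. inverse (of_real pi) * (g (pair_complex p) / (1 - v * cnj (pair_complex p))\<^sup>2))"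
  proof (rule set_lebesgue_integral_cong)
    show "\<forall>p. p \<in> unit_disc \<longrightarrow> slice_coord j (qcnj (?k (disc_embed j p)) * f (disc_embed j p) * a)
      = inverse (of_real pi) * (g (pair_complex p) / (1 - v * cnj (pair_complex p))\<^sup>2)"
      unfolding g_def
      by (simp add: bergman_element_disc_embed[OF j _ v] qcnj_slice_embed[OF j] mult.assoc slice_coord_mult[OF j])
        (simp add: disc_embed_def divide_inverse mult_ac)
  qed simp
  also have "\<dots> = inverse (of_real pi) * (of_real pi * g v)"
    unfolding set_integral_mult_right bergman_reproducing[OF hol v intg] ..
  finally show "slice_coord j (f (slice_embed j v) * a) = slice_coord j (slice_inner (ball 0 1) j ?k f * a)"
    by (simp add: g_def)
qed

lemma qcnj_slice_inner:
  assumes j: "j \<in> imag_units" and f: "f \<in> slice_bergman_space (ball 0 1) j"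
    and g: "g \<in> slice_bergman_space (ball 0 1) j"
  shows "qcnj (slice_inner (ball 0 1) j f g) = slice_inner (ball 0 1) j g f"
proof -
  note c = bergman_space_continuous_on[OF f] bergman_space_continuous_on[OF g]
  show ?thesis
    unfolding slice_inner_eq[OF j c] slice_inner_eq[OF j c(2) c(1)] set_lebesgue_integral_def
    using integral_bounded_linear[OF bounded_linear_qcnj bergman_space_integrable_product[OF j f g, unfolded set_integrable_def]]
    by (simp add: linear_scale[OF bounded_linear.linear[OF bounded_linear_qcnj]] qcnj_mult)
qed

text \<open>Uniqueness needs no Hilbert space theory: if \<open>k\<close> represents evaluation at \<open>q\<close> too, then
  \<open>k w = \<langle>K\<^sub>w, k\<rangle> = \<langle>k, K\<^sub>w\<rangle>\<^sup>* = (K\<^sub>w q)\<^sup>* = K\<^sub>q w\<close> on the slice.\<close>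

lemma evaluation_representer_eq:
  assumes j: "j \<in> imag_units" and v: "norm v < 1"
  shows "evaluation_representer (ball 0 1) j (slice_embed j v) = bergman_element (slice_embed j v)"
  unfolding evaluation_representer_def
proof (rule the_equality)
  note kin = bergman_element_in_space[OF j]
  show "bergman_element (slice_embed j v) \<in> slice_bergman_space (ball 0 1) j \<and>
     (\<forall>f\<in>slice_bergman_space (ball 0 1) j. f (slice_embed j v)
        = slice_inner (ball 0 1) j (bergman_element (slice_embed j v)) f)"
    using kin[OF v] bergman_element_reproducing[OF j v] by blast
  fix k
  assume k: "k \<in> slice_bergman_space (ball 0 1) j \<and>
     (\<forall>f\<in>slice_bergman_space (ball 0 1) j. f (slice_embed j v) = slice_inner (ball 0 1) j k f)"
  show "k = bergman_element (slice_embed j v)"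
  \<comment> \<open>Equality has to hold on the whole ball, but slice regularity reduces it to the
    slice of \<open>j\<close>.\<close>
  proof (rule slice_regular_eqI[OF _ _ j])
    show "k \<in> slice_regular (ball 0 1)" "bergman_element (slice_embed j v) \<in> slice_regular (ball 0 1)"
      using k kin[OF v] by (auto simp: slice_bergman_space_def)
    fix q assume "q \<in> slice (ball 0 1) j"
    then obtain w where q: "q = slice_embed j w" and w: "norm w < 1"
      by (auto simp: slice_eq norm_slice_embed[OF j])
    have "k q = slice_inner (ball 0 1) j (bergman_element q) k"
      using bergman_element_reproducing[OF j w] k q by blast
    also have "\<dots> = qcnj (slice_inner (ball 0 1) j k (bergman_element q))"
      using qcnj_slice_inner[OF j _ kin[OF w], of k] k q by simp
    also have "slice_inner (ball 0 1) j k (bergman_element q) = bergman_element q (slice_embed j v)"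
      using k kin[OF w] q by simp
    also have "qcnj \<dots> = bergman_element (slice_embed j v) q"
      using v w unfolding q bergman_element_def
      by (simp add: norm_slice_embed[OF j] bergman_formula_embed[OF j] qcnj_slice_embed[OF j] mult.commute)
    finally show "k q = bergman_element (slice_embed j v) q" .
  qed
qed

text \<open>The representer at \<open>z\<close> is the closed form with its arguments exchanged; the
  conjugation in the definition of the kernel restores their order, the closed form being Hermitian
  within a slice.\<close>

lemma slice_bergman_kernel_eq:
  assumes j: "j \<in> imag_units" and z: "norm z < 1" and w: "norm w < 1"
  shows "slice_bergman_kernel (ball 0 1) j (slice_embed j z) (slice_embed j w)
    = bergman_formula (slice_embed j z) (slice_embed j w)"
  unfolding slice_bergman_kernel_def evaluation_representer_eq[OF j z] bergman_element_def
  using z w by (simp add: norm_slice_embed[OF j] bergman_formula_embed[OF j] qcnj_slice_embed[OF j] mult.commute)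

section \<open>The kernel of the second kind on the ball\<close>

theorem theorem4p1:
  fixes q r :: quat
  assumes "q \<in> ball 0 1" and "r \<in> ball 0 1"
  shows "bergman_kernel_second_kind (ball 0 1) q r =
    (1 / pi) *\<^sub>R
      ((1 - 2 * qcnj q * qcnj r + (qcnj q)\<^sup>2 * (qcnj r)\<^sup>2)
       * (1 - 2 * of_real (qre q) * qcnj r + of_real ((norm q)\<^sup>2) * (qcnj r)\<^sup>2) powi (-2))"
proof -
  let ?ext = "\<lambda>i j x y. (1/2) *\<^sub>R ((1 - i * j) * slice_bergman_kernel (ball 0 1) j (slice_point j x y) r)
            + (1/2) *\<^sub>R ((1 + i * j) * slice_bergman_kernel (ball 0 1) j (slice_point j x (- y)) r)"
  \<comment> \<open>Every admissible choice of units and coordinates gives the same value, so the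
    description by \<open>THE\<close> is consistent.\<close>
  have ext: "bergman_formula q r = ?ext i j x y"
    if j: "j \<in> imag_units" and r: "r \<in> slice (ball 0 1) j" and i: "i \<in> imag_units"
      and q: "q = slice_point i x y" for i j x y
  proof -
    obtain w where w: "r = slice_embed j w" "norm w < 1"
      using r by (auto simp: slice_eq norm_slice_embed[OF j])
    have z: "norm (Complex x y) < 1"
      using assms(1) by (simp add: q slice_point_eq_embed norm_slice_embed[OF i])
    then have z': "norm (Complex x (- y)) < 1" by (simp add: cmod_def)
    show ?thesis
      using bergman_formula_representation[OF i j, of x y r]
      by (simp add: q w slice_point_eq_embed slice_bergman_kernel_eq[OF j] z z')
  qed
  have "bergman_kernel_second_kind (ball 0 1) q r = bergman_formula q r"
    unfolding bergman_kernel_second_kind_def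
  proof (rule the_equality)
    show "\<forall>j\<in>imag_units. r \<in> slice (ball 0 1) j \<longrightarrow>
       (\<forall>i\<in>imag_units. \<forall>x y. q = slice_point i x y \<longrightarrow> bergman_formula q r = ?ext i j x y)"
      using ext by blast
    fix v
    assume v: "\<forall>j\<in>imag_units. r \<in> slice (ball 0 1) j \<longrightarrow>
       (\<forall>i\<in>imag_units. \<forall>x y. q = slice_point i x y \<longrightarrow> v = ?ext i j x y)"
    \<comment> \<open>Uniqueness needs at least one admissible choice, since otherwise the condition
      on \<open>v\<close> would be vacuous.\<close>
    obtain i x y where i: "i \<in> imag_units" "q = slice_point i x y" by (rule quat_slice_cases)
    obtain j s t where j: "j \<in> imag_units" "r = slice_point j s t" by (rule quat_slice_cases)
    have r: "r \<in> slice (ball 0 1) j"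
      using assms(2) j(2) by (auto simp: slice_def slice_plane_def)
    show "v = bergman_formula q r"
      using v[rule_format, OF j(1) r i] ext[OF j(1) r i] by (simp only:)
  qed
  then show ?thesis by (simp only: bergman_formula_def)
qed

end
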